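(* Let $c=(c_1,c_2,c_3,c_4)$ with $c_1>c_2>c_3>c_4>0$. The common limit $m^\infty_*(c)$ of the components of the sequence $\{m^n(c)\}_{n\in\mathbb N}$ is $$m^\infty_*(c)=\sqrt{\frac{c_1^2-c_2^2}{c_3^2-c_4^2}}\;\frac{c_3}{F_S(z)}=\sqrt{\frac{c_1^2-c_3^2}{c_2^2-c_4^2}}\;\frac{c_2}{F_S(w)},$$ where $z=\begin{pmatrix}z_1&z_3\\ z_2&z_4\end{pmatrix}$ and $w=\begin{pmatrix}w_1&w_3\\ w_2&w_4\end{pmatrix}$ are given by $$z=\begin{pmatrix}1-\dfrac{c_3^2-c_4^2}{c_1^2-c_2^2}&1-\dfrac{c_1^2(c_3^2-c_4^2)}{c_3^2(c_1^2-c_2^2)}\\[3mm]0&1-\dfrac{c_4^2}{c_3^2}\end{pmatrix},\qquad w=\begin{pmatrix}1-\dfrac{c_4^2}{c_2^2}&0\\[3mm]1-\dfrac{c_1^2(c_2^2-c_4^2)}{c_2^2(c_1^2-c_3^2)}&1-\dfrac{c_2^2-c_4^2}{c_1^2-c_3^2}\end{pmatrix}.$$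
   Context: The map $m=(m_1,\dots,m_4):(\mathbb R_{>0})^4\to(\mathbb R_{>0})^4$ is $$m_1(u)=\frac{u_1+u_2+u_3+u_4}{4},\quad m_2(u)=\frac{\sqrt{(u_1+u_3)(u_2+u_4)}}{2},\quad m_3(u)=\frac{\sqrt{(u_1+u_2)(u_3+u_4)}}{2},\quad m_4(u)=\sqrt{\frac{u_1u_4+u_2u_3}{2}},$$ and $m^n(c)=(m_1^n(c),\dots,m_4^n(c))$ is the $n$-fold iterate of $m$ applied to $c$. For $c_1>c_2>c_3>c_4>0$ its four components converge to a common limit, denoted $m^\infty_*(c)$. The hypergeometric function $F_S$ of $z=\begin{pmatrix}z_1&z_3\\ z_2&z_4\end{pmatrix}$ is $$F_S(z)=\sum_{n\in\mathbb N^4}\frac{(\frac12)_{n_1+n_3}(\frac12)_{n_2+n_4}(\frac12)_{n_1+n_2}(\frac12)_{n_3+n_4}}{(1)_{n_1+n_3}(1)_{n_2+n_4}\,n_1!\,n_2!\,n_3!\,n_4!}\,z_1^{n_1}z_2^{n_2}z_3^{n_3}z_4^{n_4},$$ $\mathbb N=\{0,1,2,\dots\}$, $(a)_k=a(a+1)\cdots(a+k-1)$, convergent for $|z_1|+|z_2|<1$, $|z_3|+|z_4|<1$. Outside this domain $F_S(z)$ is understood through the Euler integral $$F_S(z)=\frac1{\pi^2}\int_0^1\!\!\int_0^1\frac{ds_1\,ds_2}{\sqrt{s_1(1-s_1)s_2(1-s_2)(1-z_1s_1-z_2s_2)(1-z_3s_1-z_4s_2)}}$$ (which equals the series on its domain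 of convergence), where the two linear factors are nonvanishing on $[0,1]^2$ with arguments continuous and equal to $0$ at $(s_1,s_2)=(0,0)$. *)

theory Defs
  imports "HOL-Analysis.Analysis"
begin

definition m :: "real^4 \<Rightarrow> real^4" where
  "m u = vector
     [(u$1 + u$2 + u$3 + u$4) / 4,
      sqrt ((u$1 + u$3) * (u$2 + u$4)) / 2,
      sqrt ((u$1 + u$2) * (u$3 + u$4)) / 2,
      sqrt ((u$1 * u$4 + u$2 * u$3) / 2)]"

definition m_common_limit :: "real^4 \<Rightarrow> real" where
  "m_common_limit c = (THE l. \<forall>i. (\<lambda>n. ((m ^^ n) c) $ i) \<longlonglongrightarrow> l)"

text \<open>
  The argument of the hypergeometric function is the matrix with rows
  (z1, z3) and (z2, z4), that is, z1 = z$1$1, z2 = z$2$1, z3 = z$1$2, z4 = z$2$2.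
\<close>

definition F_S_series :: "complex^2^2 \<Rightarrow> complex" where
  "F_S_series z =
     (\<Sum>\<^sub>\<infinity>(n1, n2, n3, n4) \<in> (UNIV :: (nat \<times> nat \<times> nat \<times> nat) set).
        (pochhammer (1/2) (n1 + n3) * pochhammer (1/2) (n2 + n4) *
         pochhammer (1/2) (n1 + n2) * pochhammer (1/2) (n3 + n4)) /
        (pochhammer 1 (n1 + n3) * pochhammer 1 (n2 + n4) *
         fact n1 * fact n2 * fact n3 * fact n4) *
        (z$1$1) ^ n1 * (z$2$1) ^ n2 * (z$1$2) ^ n3 * (z$2$2) ^ n4)"

text \<open>
  If 1 - a s1 - b s2 does not vanish on the closed unit square, its values there
  form a convex set containing 1 and avoiding 0, hence they also avoid the negative
  real axis (see the lemma below). So the branch of the argument that is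
  continuous on the square and equal to 0 at the origin is the principal one, and
  the square root in the Euler integral is the product of the principal square roots
  of its factors.
\<close>

lemma linear_factor_not_nonpos_Reals:
  fixes a b :: complex
  assumes nz: "\<And>s1 s2. s1 \<in> {0..1} \<Longrightarrow> s2 \<in> {0..1} \<Longrightarrow>
                 1 - a * complex_of_real s1 - b * complex_of_real s2 \<noteq> 0"
    and s: "s1 \<in> {0..1}" "s2 \<in> {0..1}"
  shows "1 - a * complex_of_real s1 - b * complex_of_real s2 \<notin> \<real>\<^sub>\<le>\<^sub>0"
proof
  assume "1 - a * complex_of_real s1 - b * complex_of_real s2 \<in> \<real>\<^sub>\<le>\<^sub>0"
  then obtain r where r: "r \<le> 0"
    and eq: "1 - a * complex_of_real s1 - b * complex_of_real s2 = of_real r"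
    by (elim nonpos_Reals_cases)
  define t where "t = 1 / (1 - r)"
  have t: "0 \<le> t" "t \<le> 1" "t * (1 - r) = 1"
    using r by (auto simp: t_def)
  have "t * s1 \<in> {0..1}" "t * s2 \<in> {0..1}"
    using s t by (auto intro: mult_le_one)
  then have "1 - a * complex_of_real (t * s1) - b * complex_of_real (t * s2) \<noteq> 0"
    by (rule nz)
  moreover have "a * complex_of_real s1 + b * complex_of_real s2 = of_real (1 - r)"
    using eq by (simp add: algebra_simps)
  then have "complex_of_real t * (a * complex_of_real s1 + b * complex_of_real s2) = 1"
    using t(3) by (metis of_real_1 of_real_mult)
  then have "1 - a * complex_of_real (t * s1) - b * complex_of_real (t * s2) = 0"
    by (simp add: algebra_simps)
  ultimately show False by contradiction
qed

definition F_S_integral :: "complex^2^2 \<Rightarrow> complex" where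
  "F_S_integral z =
     1 / (complex_of_real pi)\<^sup>2 *
     (LINT s : {0<..<1} \<times> {0<..<1} | lborel.
        (case s of (s1, s2) \<Rightarrow>
           1 / (complex_of_real (sqrt (s1 * (1 - s1) * s2 * (1 - s2))) *
                csqrt (1 - z$1$1 * complex_of_real s1 - z$2$1 * complex_of_real s2) *
                csqrt (1 - z$1$2 * complex_of_real s1 - z$2$2 * complex_of_real s2))))"

text \<open>
  The value is meaningful on the domain of convergence of the series and for those
  matrices whose two linear factors do not vanish on the closed unit square.
\<close>

definition F_S :: "complex^2^2 \<Rightarrow> complex" where
  "F_S z =
     (if norm (z$1$1) + norm (z$2$1) < 1 \<and> norm (z$1$2) + norm (z$2$2) < 1
      then F_S_series z else F_S_integral z)"

end

theory Submission
  imports Defs "HOL-Complex_Analysis.Conformal_Mappings"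
begin

text \<open>
  Gauss found the arithmetic-geometric mean of two numbers by exhibiting an elliptic integral that
  does not change when the pair is replaced by its two means.  The proof here has the same structure.
  For positive \<open>c\<close> let \<open>Q\<^sub>c(\<theta>, \<phi>)\<close> be
  \<open>c\<^sub>1\<^sup>2 cos\<^sup>2 \<theta> cos\<^sup>2 \<phi> + c\<^sub>2\<^sup>2 cos\<^sup>2 \<theta> sin\<^sup>2 \<phi> + c\<^sub>3\<^sup>2 sin\<^sup>2 \<theta> cos\<^sup>2 \<phi> + c\<^sub>4\<^sup>2 sin\<^sup>2 \<theta> sin\<^sup>2 \<phi>\<close>
  and let \<open>J(c)\<close>, called \<open>torus_mean c\<close>, be the mean of \<open>1 / sqrt Q\<^sub>c\<close> over the torus.

  Three facts give the theorem.  First, \<open>J(m c) = J(c)\<close> (\<open>torus_mean_m\<close>).  Secondly, \<open>Q\<^sub>c\<close> is a convex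
  combination of the squares of the entries, so \<open>J(c)\<close> lies between the reciprocals of the largest and the
  smallest entry; since the iterates of \<open>m\<close> contract to a constant vector, the common limit is \<open>1 / J(c)\<close>
  (\<open>iterates_of_m_converge\<close>).  Thirdly, a Moebius substitution in one variable of the Euler integral yields
  \<open>F_S z = sqrt ((c\<^sub>1\<^sup>2 - c\<^sub>2\<^sup>2) / (c\<^sub>3\<^sup>2 - c\<^sub>4\<^sup>2)) c\<^sub>3 J(c)\<close> (\<open>euler_mean_eq_torus_mean\<close>).
  As \<open>J\<close> is symmetric in \<open>c\<^sub>2\<close> and \<open>c\<^sub>3\<close>, the same formula with these two entries exchanged gives the expression
  by \<open>w\<close>.

  The invariance of \<open>J\<close> combines two one-dimensional identities, applied in different variables of a
  double integral.  One of them is Landen's transformation (\<open>circle_integral_affine_factors\<close>), which is a comparison of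
  power series.  The other one is a Moebius substitution (\<open>cosine_mean_conjugate_factors\<close>) whose parameter
  is complex; it is proved for real parameters and continued analytically.

  The function \<open>F_S\<close> is defined by its series inside the domain of convergence and by the Euler integral elsewhere.
  For real matrices with positive linear factors both are shown to be the same mean (\<open>F_S_eq_euler_mean\<close>).
\<close>

section \<open>Means against the arcsine law\<close>

text \<open>
  The mean over \<open>[0, \<pi>]\<close> of a function of the cosine, that is, its mean against the arcsine law
  on \<open>[-1, 1]\<close>.  Written as a functional of \<open>f\<close>, the trigonometric substitutions
  needed below become algebraic changes of variable on \<open>[-1, 1]\<close>.
\<close>

definition cosine_mean :: "(real \<Rightarrow> 'a::euclidean_space) \<Rightarrow> 'a" where
  "cosine_mean f = (1 / pi) *\<^sub>R integral {0..pi} (\<lambda>t. f (cos t))"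

lemma cosine_mean_cong:
  assumes "\<And>x. \<bar>x\<bar> \<le> 1 \<Longrightarrow> f x = g x"
  shows "cosine_mean f = cosine_mean g"
  using assms by (simp add: cosine_mean_def abs_le_iff)

lemma continuous_on_compose_cos:
  assumes "continuous_on {-1..1} f"
  shows "continuous_on A (\<lambda>t::real. f (cos t))"
  by (rule continuous_on_compose2[OF assms]) (auto intro!: continuous_intros)

lemma integrable_compose_cos:
  fixes f :: "real \<Rightarrow> 'a::euclidean_space"
  assumes "continuous_on {-1..1} f"
  shows "(\<lambda>t. f (cos t)) integrable_on {a..b}"
  by (intro integrable_continuous_interval continuous_on_compose_cos assms)

lemma cosine_mean_const [simp]: "cosine_mean (\<lambda>x. c) = c"
  by (simp add: cosine_mean_def)

lemma cosine_mean_scaleR: "cosine_mean (\<lambda>x. k *\<^sub>R f x) = k *\<^sub>R cosine_mean f"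
  by (simp add: cosine_mean_def)

lemma cosine_mean_mult_left: "cosine_mean (\<lambda>x. k * f x) = k * cosine_mean f" for k :: real
  using cosine_mean_scaleR[of k f] by simp

lemma cosine_mean_of_real:
  assumes "continuous_on {-1..1} f"
  shows "cosine_mean (\<lambda>x. complex_of_real (f x)) = of_real (cosine_mean f)"
proof -
  have "integral {0..pi} (\<lambda>t. complex_of_real (f (cos t))) = of_real (integral {0..pi} (\<lambda>t. f (cos t)))"
    using integral_linear[OF integrable_compose_cos[OF assms] bounded_linear_of_real, of 0 pi]
    by (simp add: o_def)
  then show ?thesis by (simp add: cosine_mean_def scaleR_conv_of_real)
qed

lemma cosine_mean_mono:
  fixes f g :: "real \<Rightarrow> real"
  assumes "continuous_on {-1..1} f" "continuous_on {-1..1} g" "\<And>x. \<bar>x\<bar> \<le> 1 \<Longrightarrow> f x \<le> g x"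
  shows "cosine_mean f \<le> cosine_mean g"
  using assms
  by (auto simp: cosine_mean_def abs_le_iff intro!: divide_right_mono integral_le integrable_compose_cos)

lemma continuous_on_cosine_mean:
  fixes f :: "'b::metric_space \<Rightarrow> real \<Rightarrow> 'a::euclidean_space"
  assumes "continuous_on (A \<times> {-1..1}) (\<lambda>(x, y). f x y)"
  shows "continuous_on A (\<lambda>x. cosine_mean (f x))"
proof -
  have "continuous_on (A \<times> cbox 0 pi) (\<lambda>(x, t). f x (cos t))"
    unfolding split_def
    by (rule continuous_on_compose2[OF assms, of _ "\<lambda>p. (fst p, cos (snd p))", simplified])
       (auto intro!: continuous_intros)
  from integral_continuous_on_param[OF this] show ?thesis
    by (auto simp: cosine_mean_def intro!: continuous_intros)
qed

lemma cosine_mean_swap: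
  fixes f :: "real \<Rightarrow> real \<Rightarrow> 'a::euclidean_space"
  assumes "continuous_on ({-1..1} \<times> {-1..1}) (\<lambda>(x, y). f x y)"
  shows "cosine_mean (\<lambda>x. cosine_mean (\<lambda>y. f x y)) = cosine_mean (\<lambda>y. cosine_mean (\<lambda>x. f x y))"
proof -
  have "continuous_on (cbox (0,0) (pi,pi)) (\<lambda>(s, t). f (cos s) (cos t))"
    unfolding split_def
    by (rule continuous_on_compose2[OF assms, of _ "\<lambda>p. (cos (fst p), cos (snd p))", simplified])
       (auto intro!: continuous_intros)
  from integral_swap_continuous[OF this] show ?thesis
    by (simp add: cosine_mean_def)
qed

lemma cosine_mean_integral_swap:
  fixes f :: "real \<Rightarrow> real \<Rightarrow> 'a::euclidean_space"
  assumes "continuous_on ({-1..1} \<times> {a..b}) (\<lambda>(x, t). f x t)"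
  shows "cosine_mean (\<lambda>x. integral {a..b} (f x)) = integral {a..b} (\<lambda>t. cosine_mean (\<lambda>x. f x t))"
proof -
  have "continuous_on (cbox (0,a) (pi,b)) (\<lambda>(s, t). f (cos s) t)"
    unfolding split_def
    by (rule continuous_on_compose2[OF assms, of _ "\<lambda>p. (cos (fst p), snd p)", simplified])
       (auto intro!: continuous_intros)
  from integral_swap_continuous[OF this] show ?thesis
    by (simp add: cosine_mean_def)
qed

lemma integral_of_cos_argument:
  fixes f :: "real \<Rightarrow> 'a::euclidean_space"
  assumes f: "continuous_on {-1..1} f"
  shows "integral {- pi..pi} (\<lambda>t. f (cos t)) = (2 * pi) *\<^sub>R cosine_mean f"
proof -
  have "integral {- pi..pi} (\<lambda>t. f (cos t))
      = integral {- pi..0} (\<lambda>t. f (cos t)) + integral {0..pi} (\<lambda>t. f (cos t))"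
    by (rule Henstock_Kurzweil_Integration.integral_combine[symmetric]) (auto intro: integrable_compose_cos f)
  also have "integral {- pi..0} (\<lambda>t. f (cos t)) = integral {0..pi} (\<lambda>t. f (cos t))"
    using Henstock_Kurzweil_Integration.integral_reflect_real[of pi 0 "\<lambda>t. f (cos t)"]
     Henstock_Kurzweil_Integration.integral_reflect_real[of 0 pi "\<lambda>t. f (cos t)"] by simp
  finally show ?thesis by (simp add: cosine_mean_def scaleR_2[symmetric])
qed

lemma cosine_mean_reflect:
  fixes f :: "real \<Rightarrow> 'a::euclidean_space"
  assumes f: "continuous_on {-1..1} f"
  shows "cosine_mean (\<lambda>x. f (- x)) = cosine_mean f"
proof -
  have "((\<lambda>t. (-1) *\<^sub>R f (cos (pi - t))) has_integral
      integral {pi - 0..pi - pi} (\<lambda>t. f (cos t)) - integral {pi - pi..pi - 0} (\<lambda>t. f (cos t))) {0..pi}"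
    by (rule has_integral_substitution_general[where s = "{}" and c = 0 and d = pi])
       (auto intro!: continuous_on_compose_cos f continuous_intros derivative_eq_intros)
  then have "((\<lambda>t. - f (- cos t)) has_integral - integral {0..pi} (\<lambda>t. f (cos t))) {0..pi}"
    by (simp add: cos_diff)
  then have "integral {0..pi} (\<lambda>t. - f (- cos t)) = - integral {0..pi} (\<lambda>t. f (cos t))"
    by (rule integral_unique)
  then show ?thesis by (simp add: cosine_mean_def)
qed

text \<open>
  The arcsine law is invariant under the Chebyshev map \<open>x \<mapsto> 2 x\<^sup>2 - 1\<close>, because
  \<open>cos (2 t) = 2 (cos t)\<^sup>2 - 1\<close> and doubling the angle wraps the circle twice around itself.
\<close>

lemma cosine_mean_double_angle:
  fixes f :: "real \<Rightarrow> 'a::euclidean_space"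
  assumes f: "continuous_on {0..1} f"
  shows "cosine_mean (\<lambda>x. f (x\<^sup>2)) = cosine_mean (\<lambda>x. f ((1 + x) / 2))"
proof -
  define h where "h = (\<lambda>x. f ((1 + x) / 2))"
  have h: "continuous_on {-1..1} h"
    unfolding h_def by (rule continuous_on_compose2[OF f]) (auto intro!: continuous_intros)
  have hcos: "h (cos (2 * t)) = f ((cos t)\<^sup>2)" for t
    by (simp add: h_def cos_double_cos)
  have "((\<lambda>t. 2 *\<^sub>R h (cos (2 * t))) has_integral integral {2 * 0..2 * pi} (\<lambda>t. h (cos t))) {0..pi}"
    by (rule has_integral_substitution_strong[where s = "{}" and c = 0 and d = "2 * pi"])
       (auto intro!: continuous_on_compose_cos h continuous_intros derivative_eq_intros)
  then have 1: "2 *\<^sub>R integral {0..pi} (\<lambda>t. f ((cos t)\<^sup>2)) = integral {0..2 * pi} (\<lambda>t. h (cos t))"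
    by (auto simp: hcos dest: integral_unique)
  \<comment> \<open>reflection at \<open>\<pi>\<close>: both halves of the doubled circle contribute equally\<close>
  have "((\<lambda>t. (-1) *\<^sub>R h (cos (2 * pi - t))) has_integral
      integral {2 * pi - 0..2 * pi - pi} (\<lambda>t. h (cos t)) - integral {2 * pi - pi..2 * pi - 0} (\<lambda>t. h (cos t))) {0..pi}"
    by (rule has_integral_substitution_general[where s = "{}" and c = pi and d = "2 * pi"])
       (auto intro!: continuous_on_compose_cos h continuous_intros derivative_eq_intros)
  then have "integral {0..pi} (\<lambda>t. - h (cos t)) = - integral {pi..2 * pi} (\<lambda>t. h (cos t))"
    by (intro integral_unique) (simp add: cos_diff)
  moreover have "integral {0..2 * pi} (\<lambda>t. h (cos t))
      = integral {0..pi} (\<lambda>t. h (cos t)) + integral {pi..2 * pi} (\<lambda>t. h (cos t))"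
    by (rule Henstock_Kurzweil_Integration.integral_combine[symmetric]) (auto intro: integrable_compose_cos h)
  ultimately have "2 *\<^sub>R integral {0..pi} (\<lambda>t. f ((cos t)\<^sup>2)) = 2 *\<^sub>R integral {0..pi} (\<lambda>t. h (cos t))"
    using 1 by (simp add: scaleR_2)
  then show ?thesis by (simp add: cosine_mean_def h_def)
qed

lemma cosine_mean_half_angle:
  fixes f :: "real \<Rightarrow> 'a::euclidean_space"
  assumes f: "continuous_on {0..1} f"
  shows "cosine_mean (\<lambda>x. f ((1 - x) / 2)) = cosine_mean (\<lambda>x. f (x\<^sup>2))"
proof -
  have "continuous_on {-1..1} (\<lambda>x. f ((1 + x) / 2))"
    by (rule continuous_on_compose2[OF f]) (auto intro!: continuous_intros)
  from cosine_mean_reflect[OF this] cosine_mean_double_angle[OF f] show ?thesis by simp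
qed

text \<open>
  A Moebius map fixing \<open>1\<close> and \<open>-1\<close> multiplies \<open>(1 + x) / (1 - x)\<close> by a constant, here by
  \<open>p / q\<close>.  In the angle \<open>t\<close> with \<open>x = cos t\<close> its derivative is exactly the weight in front of \<open>f\<close>,
  so the statement is a substitution.  It serves twice: to identify two elliptic integrals
  with the same cross ratio of branch points, and to bring the Euler integral into
  symmetric form.
\<close>

lemma cosine_mean_Moebius:
  fixes f :: "real \<Rightarrow> 'a::euclidean_space"
  assumes f: "continuous_on {-1..1} f" and p: "p > 0" and q: "q > 0"
  shows "cosine_mean (\<lambda>x. (2 * sqrt (p * q) / (p * (1 + x) + q * (1 - x))) *\<^sub>R
            f ((p * (1 + x) - q * (1 - x)) / (p * (1 + x) + q * (1 - x)))) = cosine_mean f"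
proof -
  define D where "D = (\<lambda>x. p * (1 + x) + q * (1 - x))"
  define \<mu> where "\<mu> = (\<lambda>x. (p * (1 + x) - q * (1 - x)) / D x)"
  have D: "D x > 0" if "\<bar>x\<bar> \<le> 1" for x
  proof (cases "x = 1")
    case True then show ?thesis using p by (simp add: D_def)
  next
    case False
    with that have "1 - x > 0" "1 + x \<ge> 0" by auto
    then show ?thesis using p q by (auto simp: D_def intro: add_nonneg_pos)
  qed
  have Dc: "D (cos t) > 0" for t by (rule D) simp
  have sq: "1 - (\<mu> x)\<^sup>2 = 4 * p * q * (1 - x\<^sup>2) / (D x)\<^sup>2" if "\<bar>x\<bar> \<le> 1" for x
  proof -
    have "(D x)\<^sup>2 - (p * (1 + x) - q * (1 - x))\<^sup>2 = 4 * p * q * (1 - x\<^sup>2)"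
      by (simp add: D_def power2_eq_square algebra_simps)
    then show ?thesis using D[OF that] by (simp add: \<mu>_def power_divide field_simps)
  qed
  have \<mu>le: "\<bar>\<mu> x\<bar> \<le> 1" if "\<bar>x\<bar> \<le> 1" for x
  proof -
    have "x\<^sup>2 \<le> 1" using that by (simp add: abs_square_le_1)
    then have "0 \<le> 1 - (\<mu> x)\<^sup>2" using p q by (simp add: sq[OF that])
    then show ?thesis by (simp add: abs_square_le_1)
  qed
  have \<mu>c: "-1 \<le> \<mu> (cos t)" "\<mu> (cos t) \<le> 1" for t
    using \<mu>le[of "cos t"] by (auto simp: abs_le_iff)
  define \<beta> where "\<beta> = (\<lambda>t. arccos (\<mu> (cos t)))"
  have "((\<lambda>t. (2 * sqrt (p * q) / D (cos t)) *\<^sub>R f (cos (\<beta> t))) has_integral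
      integral {\<beta> 0..\<beta> pi} (\<lambda>t. f (cos t))) {0..pi}"
  proof (rule has_integral_substitution_strong[where s = "{0, pi}" and c = 0 and d = pi])
    show "\<beta> 0 \<le> \<beta> pi" using p q by (simp add: \<beta>_def \<mu>_def D_def)
    show "\<beta> ` {0..pi} \<subseteq> {0..pi}"
      using \<mu>c by (auto simp: \<beta>_def intro!: arccos_lbound arccos_ubound)
    show "continuous_on {0..pi} \<beta>"
      unfolding \<beta>_def \<mu>_def D_def
      using Dc \<mu>c by (intro continuous_intros) (auto simp: D_def \<mu>_def less_imp_neq[symmetric])
    show "continuous_on {0..pi} (\<lambda>t. f (cos t))" by (rule continuous_on_compose_cos[OF f])
    fix t :: real assume t: "t \<in> {0..pi} - {0, pi}"
    then have st: "sin t > 0" by (auto intro: sin_gt_zero)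
    have "1 - (\<mu> (cos t))\<^sup>2 = (2 * sqrt (p * q) * sin t / D (cos t))\<^sup>2"
      using p q sq[of "cos t"] by (simp add: power_mult_distrib power_divide sin_squared_eq)
    then have rt: "sqrt (1 - (\<mu> (cos t))\<^sup>2) = 2 * sqrt (p * q) * sin t / D (cos t)"
      using st Dc[of t] p q by (simp add: real_sqrt_unique)
    have "sqrt (1 - (\<mu> (cos t))\<^sup>2) > 0" unfolding rt using st Dc[of t] p q by simp
    then have "(\<mu> (cos t))\<^sup>2 < 1" by simp
    then have lt: "-1 < \<mu> (cos t)" "\<mu> (cos t) < 1" by (auto simp: abs_square_less_1 abs_less_iff)
    have d\<mu>: "((\<lambda>t. \<mu> (cos t)) has_field_derivative (4 * p * q * - sin t / (D (cos t))\<^sup>2)) (at t within {0..pi})"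
      unfolding \<mu>_def D_def
      using Dc[of t]
      by (auto intro!: derivative_eq_intros simp: D_def divide_simps power2_eq_square less_imp_neq[symmetric]) (simp add: algebra_simps)
    have "(\<beta> has_field_derivative inverse (- sqrt (1 - (\<mu> (cos t))\<^sup>2)) * (4 * p * q * - sin t / (D (cos t))\<^sup>2)) (at t within {0..pi})"
      unfolding \<beta>_def by (rule DERIV_chain2[OF DERIV_arccos d\<mu>]) (use lt in auto)
    also have "inverse (- sqrt (1 - (\<mu> (cos t))\<^sup>2)) * (4 * p * q * - sin t / (D (cos t))\<^sup>2) = 2 * sqrt (p * q) / D (cos t)"
    proof -
      have "4 * p * q = (2 * sqrt (p * q))\<^sup>2" using p q by simp
      then show ?thesis
        unfolding rt using st Dc[of t] p q by (simp add: field_simps power2_eq_square)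
    qed
    finally show "(\<beta> has_field_derivative 2 * sqrt (p * q) / D (cos t)) (at t within {0..pi})" .
  qed auto
  moreover have "\<beta> 0 = 0" "\<beta> pi = pi" using p q by (simp_all add: \<beta>_def \<mu>_def D_def)
  moreover have "cos (\<beta> t) = \<mu> (cos t)" for t using \<mu>c by (simp add: \<beta>_def)
  ultimately have "integral {0..pi} (\<lambda>t. (2 * sqrt (p * q) / D (cos t)) *\<^sub>R f (\<mu> (cos t))) = integral {0..pi} (\<lambda>t. f (cos t))"
    by (auto intro: integral_unique)
  then show ?thesis by (simp add: cosine_mean_def D_def \<mu>_def)
qed

text \<open>
  Wallis' formula; integration by parts appears as the derivative of \<open>sin t * cos t ^ (2 k + 1)\<close>.
\<close>

lemma cosine_mean_even_power: "cosine_mean (\<lambda>x. x ^ (2 * k)) = pochhammer (1/2) k / fact k"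
proof (induction k)
  case 0 then show ?case by simp
next
  case (Suc k)
  have aux: "X = b / a * Y" if "a * X = b * Y" "a \<noteq> 0" for a b X Y :: real
    using that by (simp add: field_simps)
  have "((\<lambda>t::real. real (2 * k + 2) * cos t ^ (2 * k + 2) - real (2 * k + 1) * cos t ^ (2 * k)) has_integral
      sin pi * cos pi ^ (2 * k + 1) - sin 0 * cos 0 ^ (2 * k + 1)) {0..pi}"
  proof (rule fundamental_theorem_of_calculus)
    fix t :: real
    have s: "sin t * sin t = 1 - cos t * cos t" by (simp flip: power2_eq_square add: sin_squared_eq)
    have "((\<lambda>t. sin t * cos t ^ (2 * k + 1)) has_real_derivative
        cos t * cos t ^ (2 * k + 1) - real (2 * k + 1) * cos t ^ (2 * k) * (sin t * sin t)) (at t within {0..pi})"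
      by (rule derivative_eq_intros refl | simp add: mult.assoc)+
    then show "((\<lambda>t. sin t * cos t ^ (2 * k + 1)) has_vector_derivative
        real (2 * k + 2) * cos t ^ (2 * k + 2) - real (2 * k + 1) * cos t ^ (2 * k)) (at t within {0..pi})"
      unfolding has_real_derivative_iff_has_vector_derivative[symmetric] s by (simp add: algebra_simps)
  qed simp
  then have "integral {0..pi} (\<lambda>t::real. real (2 * k + 2) * cos t ^ (2 * k + 2) - real (2 * k + 1) * cos t ^ (2 * k)) = 0"
    by (simp add: integral_unique)
  then have "real (2 * k + 2) * integral {0..pi} (\<lambda>t. cos t ^ (2 * k + 2)) = real (2 * k + 1) * integral {0..pi} (\<lambda>t. cos t ^ (2 * k))"
    by (subst (asm) Henstock_Kurzweil_Integration.integral_diff)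
       (auto intro!: integrable_continuous_interval continuous_intros)
  then have "real (2 * k + 2) * cosine_mean (\<lambda>x. x ^ (2 * Suc k)) = real (2 * k + 1) * cosine_mean (\<lambda>x. x ^ (2 * k))"
    by (simp add: cosine_mean_def divide_simps del: power_Suc)
  then have "cosine_mean (\<lambda>x. x ^ (2 * Suc k)) = real (2 * k + 1) / real (2 * k + 2) * cosine_mean (\<lambda>x. x ^ (2 * k))"
    using aux[of "real (2 * k + 2)"] by simp
  also have "\<dots> = pochhammer (1/2) (Suc k) / fact (Suc k)"
    unfolding Suc.IH by (simp add: pochhammer_Suc divide_simps)
  finally show ?case .
qed

section \<open>The circle integral of two conjugate binomial factors\<close>

lemma has_sum_integral_cbox:
  fixes f :: "'i \<Rightarrow> 'b::euclidean_space \<Rightarrow> 'c::banach"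
  assumes bound: "\<And>n t. n \<in> I \<Longrightarrow> t \<in> cbox a b \<Longrightarrow> norm (f n t) \<le> M n"
    and M: "M summable_on I"
    and cont: "\<And>n. continuous_on (cbox a b) (f n)"
    and sum: "\<And>t. t \<in> cbox a b \<Longrightarrow> ((\<lambda>n. f n t) has_sum S t) I"
  shows "((\<lambda>n. integral (cbox a b) (f n)) has_sum integral (cbox a b) S) I"
proof -
  have "uniform_limit (cbox a b) (\<lambda>X t. \<Sum>n\<in>X. f n t) S (finite_subsets_at_top I)"
    by (rule Weierstrass_m_test_general'[OF bound sum M])
  then obtain J L where J: "\<And>X. ((\<lambda>t. \<Sum>n\<in>X. f n t) has_integral J X) (cbox a b)"
    and L: "(S has_integral L) (cbox a b)" and lim: "(J \<longlongrightarrow> L) (finite_subsets_at_top I)"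
    by (rule uniform_limit_integral_cbox) (auto intro!: continuous_on_sum cont)
  have "J X = (\<Sum>n\<in>X. integral (cbox a b) (f n))" if "finite X" for X
    using integral_unique[OF J[of X]] that
    by (simp add: integral_sum integrable_continuous cont)
  then have "((\<lambda>X. \<Sum>n\<in>X. integral (cbox a b) (f n)) \<longlongrightarrow> L) (finite_subsets_at_top I)"
    using lim by (auto elim!: Lim_transform_eventually intro!: eventually_finite_subsets_at_top_weakI)
  then show ?thesis using L by (simp add: has_sum_def integral_unique)
qed

text \<open>
  These are both the coefficients of \<open>1 / sqrt (1 - z)\<close> and, by Wallis' formula, the even moments
  of the arcsine law.  This coincidence is what makes the Landen transformation below work.
\<close>

definition inv_sqrt_coeff :: "nat \<Rightarrow> real" where
  "inv_sqrt_coeff n = pochhammer (1/2) n / fact n"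

lemma inv_sqrt_coeff_nonneg [simp]: "0 \<le> inv_sqrt_coeff n"
  by (simp add: inv_sqrt_coeff_def pochhammer_nonneg)

lemma inv_sqrt_coeff_le_1: "inv_sqrt_coeff n \<le> 1"
proof (induction n)
  case (Suc n)
  have "inv_sqrt_coeff (Suc n) = inv_sqrt_coeff n * ((1/2 + real n) / (1 + real n))"
    by (simp add: inv_sqrt_coeff_def pochhammer_Suc divide_simps)
  also have "\<dots> \<le> 1 * 1" using Suc by (intro mult_mono) (auto simp: divide_simps)
  finally show ?case by simp
qed (simp add: inv_sqrt_coeff_def)

lemma summable_inv_sqrt_coeff:
  assumes "0 \<le> r" "r < 1"
  shows "summable (\<lambda>n. inv_sqrt_coeff n * r ^ n)"
proof (rule summable_comparison_test')
  show "summable (\<lambda>n. r ^ n)" using assms by (intro summable_geometric) auto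
  show "norm (inv_sqrt_coeff n * r ^ n) \<le> r ^ n" if "n \<ge> 0" for n
    using assms inv_sqrt_coeff_le_1[of n] by (simp add: abs_mult mult_left_le_one_le)
qed

lemma has_sum_inv_csqrt:
  fixes z :: complex
  assumes "norm z < 1"
  shows "((\<lambda>n. of_real (inv_sqrt_coeff n) * z ^ n) has_sum 1 / csqrt (1 - z)) UNIV"
proof (rule norm_summable_imp_has_sum)
  show "summable (\<lambda>n. norm (of_real (inv_sqrt_coeff n) * z ^ n))"
    using summable_inv_sqrt_coeff[of "norm z"] assms by (simp add: norm_mult norm_power)
  have "((-1/2 :: complex) gchoose n) * (-z) ^ n = of_real (inv_sqrt_coeff n) * z ^ n" for n
  proof -
    have "pochhammer (1/2 :: complex) n = of_real (pochhammer (1/2) n)"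
      by (metis of_real_divide of_real_1 of_real_numeral pochhammer_of_real)
    moreover have "(-1) ^ n * (- z) ^ n = z ^ n"
      by (simp flip: power_mult_distrib)
    ultimately show ?thesis by (simp add: gbinomial_pochhammer inv_sqrt_coeff_def)
  qed
  moreover have "(1 + - z) powr (-1/2) = 1 / csqrt (1 - z)"
    by (simp add: csqrt_conv_powr powr_minus_divide)
  ultimately show "(\<lambda>n. of_real (inv_sqrt_coeff n) * z ^ n) sums (1 / csqrt (1 - z))"
    using gen_binomial_complex[of "- z" "-1/2"] assms by simp
qed

text \<open>
  The second conclusion provides the majorant for integrating such a double series term by term.
\<close>

lemma has_sum_times:
  fixes f :: "'i \<Rightarrow> 'c::{real_normed_field, banach}" and g :: "'j \<Rightarrow> 'c"
  assumes f: "(f has_sum S) I" "(\<lambda>i. norm (f i)) summable_on I" and g: "(g has_sum T) J" "(\<lambda>j. norm (g j)) summable_on J"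
  shows "((\<lambda>(i, j). f i * g j) has_sum S * T) (I \<times> J)"
    and "(\<lambda>(i, j). norm (f i) * norm (g j)) summable_on I \<times> J"
proof -
  show abs: "(\<lambda>(i, j). norm (f i) * norm (g j)) summable_on I \<times> J"
  proof (rule summable_on_SigmaI[where g = "\<lambda>i. norm (f i) * (\<Sum>\<^sub>\<infinity>j\<in>J. norm (g j))"])
    show "((\<lambda>j. case (i, j) of (i, j) \<Rightarrow> norm (f i) * norm (g j)) has_sum norm (f i) * (\<Sum>\<^sub>\<infinity>j\<in>J. norm (g j))) J" for i
      unfolding prod.case by (rule has_sum_cmult_right[OF has_sum_infsum[OF g(2)]])
    show "(\<lambda>i. norm (f i) * (\<Sum>\<^sub>\<infinity>j\<in>J. norm (g j))) summable_on I"
      using f(2) by (rule summable_on_cmult_left)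
  qed auto
  show "((\<lambda>(i, j). f i * g j) has_sum S * T) (I \<times> J)"
  proof (rule has_sum_SigmaI[where g = "\<lambda>i. f i * T"])
    show "((\<lambda>j. case (i, j) of (i, j) \<Rightarrow> f i * g j) has_sum f i * T) J" for i
      unfolding prod.case by (rule has_sum_cmult_right[OF g(1)])
    show "((\<lambda>i. f i * T) has_sum S * T) I" using f(1) by (rule has_sum_cmult_left)
    show "(\<lambda>(i, j). f i * g j) summable_on I \<times> J"
      using abs by - (rule abs_summable_summable, simp only: split_def norm_mult)
  qed
qed

lemma integral_cis:
  "integral {- pi..pi} (\<lambda>t. cis (of_int k * t)) = (if k = 0 then of_real (2 * pi) else 0)"
proof (cases "k = 0")
  case False
  have "((\<lambda>t. cis (of_int k * t)) has_integral
      cis (of_int k * pi) / (\<i> * of_int k) - cis (of_int k * (- pi)) / (\<i> * of_int k)) {- pi..pi}"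
    using False
    by (intro fundamental_theorem_of_calculus)
       (auto intro!: derivative_eq_intros simp: divide_simps has_vector_derivative_def scaleR_conv_of_real mult_ac)
  moreover have "cis (of_int k * (- pi)) = cis (of_int k * pi)"
    using sin_npi_int[of k] by (simp add: complex_eq_iff mult.commute)
  ultimately show ?thesis using False by (simp add: integral_unique)
qed (simp add: scaleR_conv_of_real)

text \<open>
  Landen's transformation in the form of a power series identity.  Expanding both factors on
  the left, orthogonality of the characters \<open>cis (k * t)\<close> keeps only the diagonal terms
  \<open>g\<^sub>k\<^sup>2 (u v)\<^sup>k\<close>, where \<open>g\<^sub>k\<close> is the coefficient of \<open>z ^ k\<close> in \<open>1 / sqrt (1 - z)\<close>.  On the right one factor \<open>g\<^sub>k\<close>
  comes from the binomial series and the other one from the \<open>2 k\<close>-th moment of the arcsine law.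
\<close>

lemma circle_integral_inv_csqrt_factors:
  fixes u v :: complex
  assumes u: "norm u < 1" and v: "norm v < 1"
  shows "integral {- pi..pi} (\<lambda>t. 1 / (csqrt (1 + u * cis t) * csqrt (1 + v * cis (- t))))
       = 2 * pi * cosine_mean (\<lambda>x. 1 / csqrt (1 - u * v * (of_real x)\<^sup>2))"
proof -
  define g where "g = inv_sqrt_coeff"
  define F where "F = (\<lambda>(j, k) t. (of_real (g j) * (- u * cis t) ^ j) * (of_real (g k) * (- v * cis (- t)) ^ k))"
  have un: "norm (- u * cis t) < 1" and vn: "norm (- v * cis t) < 1" for t
    using u v by (simp_all add: norm_mult)
  have ser: "(\<lambda>n. norm (of_real (g n) * z ^ n)) summable_on UNIV" if "norm z < 1" for z :: complex
    using summable_inv_sqrt_coeff[of "norm z"] that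
    by (intro summable_nonneg_imp_summable_on) (simp_all add: g_def norm_mult norm_power abs_mult)
  have uv: "norm (u * v * (of_real (cos t))\<^sup>2) < 1" for t :: real
  proof -
    have "norm (u * v * (of_real (cos t))\<^sup>2) \<le> norm u * 1 * 1"
      unfolding norm_mult norm_power using v by (intro mult_mono) (auto simp: abs_square_le_1)
    then show ?thesis using u by simp
  qed
  have "((\<lambda>n. integral (cbox (- pi) pi) (F n)) has_sum
      integral (cbox (- pi) pi) (\<lambda>t. 1 / csqrt (1 - (- u * cis t)) * (1 / csqrt (1 - (- v * cis (- t)))))) (UNIV \<times> UNIV)"
  proof (rule has_sum_integral_cbox)
    show "(\<lambda>(j, k). norm (of_real (g j) * (- u) ^ j) * norm (of_real (g k) * (- v) ^ k)) summable_on UNIV \<times> UNIV"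
      using u v by (intro has_sum_times(2)[OF has_sum_infsum[OF abs_summable_summable] _ has_sum_infsum[OF abs_summable_summable]] ser) auto
    show "norm (F n t) \<le> (case n of (j, k) \<Rightarrow> norm (of_real (g j) * (- u) ^ j) * norm (of_real (g k) * (- v) ^ k))" for n t
      by (auto simp: F_def norm_mult norm_power split: prod.split)
    show "continuous_on (cbox (- pi) pi) (F n)" for n
      unfolding F_def by (cases n) (auto intro!: continuous_intros)
    show "((\<lambda>n. F n t) has_sum 1 / csqrt (1 - (- u * cis t)) * (1 / csqrt (1 - (- v * cis (- t))))) (UNIV \<times> UNIV)" for t
      using has_sum_times(1)[OF has_sum_inv_csqrt[OF un[of t]] _ has_sum_inv_csqrt[OF vn[of "-t"]]] ser[OF un[of t]] ser[OF vn[of "-t"]]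
      by (simp add: F_def g_def split_def)
  qed
  moreover have "integral (cbox (- pi) pi) (F n) = (case n of (j, k) \<Rightarrow>
      if j = k then of_real (2 * pi * (g j)\<^sup>2) * (u * v) ^ j else 0)" for n
  proof (cases n)
    case (Pair j k)
    have "F n t = of_real (g j * g k) * (- u) ^ j * (- v) ^ k * cis (of_int (int j - int k) * t)" for t
    proof -
      have *: "cis (of_int (int j - int k) * t) = cis t ^ j * cis (- t) ^ k"
        by (simp add: Complex.DeMoivre cis_mult left_diff_distrib)
      have "of_real (g j * g k) * (- u) ^ j * (- v) ^ k * cis (of_int (int j - int k) * t)
          = (of_real (g j) * ((- u) ^ j * cis t ^ j)) * (of_real (g k) * ((- v) ^ k * cis (- t) ^ k))"
        unfolding * by (simp only: mult_ac of_real_mult)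
      then show ?thesis by (simp only: Pair F_def power_mult_distrib prod.case)
    qed
    then have "F n = (\<lambda>t. of_real (g j * g k) * (- u) ^ j * (- v) ^ k * cis (of_int (int j - int k) * t))"
      by (rule ext)
    then have "integral {- pi..pi} (F n) = of_real (g j * g k) * (- u) ^ j * (- v) ^ k * integral {- pi..pi} (\<lambda>t. cis (of_int (int j - int k) * t))"
      by (simp only: integral_mult_right)
    then show ?thesis
      unfolding integral_cis by (simp add: Pair power2_eq_square flip: power_mult_distrib)
  qed
  ultimately have L: "((\<lambda>(j, k). if j = k then of_real (2 * pi * (g j)\<^sup>2) * (u * v) ^ j else 0) has_sum
      integral {- pi..pi} (\<lambda>t. 1 / (csqrt (1 + u * cis t) * csqrt (1 + v * cis (- t))))) (UNIV \<times> UNIV)"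
    by (simp add: cond_case_prod_eta)
  have inj: "inj (\<lambda>j::nat. (j, j))" by (rule injI) simp
  have "((\<lambda>(j, k). of_real (2 * pi * (g j)\<^sup>2) * (u * v) ^ j) has_sum
      integral {- pi..pi} (\<lambda>t. 1 / (csqrt (1 + u * cis t) * csqrt (1 + v * cis (- t))))) (range (\<lambda>j. (j, j)))"
    by (rule has_sum_cong_neutral[THEN iffD1, OF _ _ _ L]) auto
  then have L': "((\<lambda>j. of_real (2 * pi * (g j)\<^sup>2) * (u * v) ^ j) has_sum
      integral {- pi..pi} (\<lambda>t. 1 / (csqrt (1 + u * cis t) * csqrt (1 + v * cis (- t))))) UNIV"
    by (subst (asm) has_sum_reindex[OF inj]) (simp add: o_def)
  have "((\<lambda>n. integral (cbox 0 pi) (\<lambda>t. of_real (g n) * (u * v * (of_real (cos t))\<^sup>2) ^ n)) has_sum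
      integral (cbox 0 pi) (\<lambda>t. 1 / csqrt (1 - u * v * (of_real (cos t))\<^sup>2))) UNIV"
  proof (rule has_sum_integral_cbox)
    have "norm (u * v) < 1" using uv[of 0] by simp
    then show "(\<lambda>n. norm (of_real (g n) * (u * v) ^ n)) summable_on UNIV" by (rule ser)
    show "norm (of_real (g n) * (u * v * (of_real (cos t))\<^sup>2) ^ n) \<le> norm (of_real (g n) * (u * v) ^ n)" for n and t :: real
      unfolding norm_mult norm_power
      by (intro mult_left_mono power_mono mult_right_le_one_le) (auto simp: abs_square_le_1)
    show "((\<lambda>n. of_real (g n) * (u * v * (of_real (cos t))\<^sup>2) ^ n) has_sum
        1 / csqrt (1 - u * v * (of_real (cos t))\<^sup>2)) UNIV" for t :: real
      unfolding g_def by (rule has_sum_inv_csqrt[OF uv])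
  qed (auto intro!: continuous_intros)
  moreover have "integral (cbox 0 pi) (\<lambda>t. of_real (g n) * (u * v * (of_real (cos t))\<^sup>2) ^ n)
      = of_real (pi * (g n)\<^sup>2) * (u * v) ^ n" for n
  proof -
    have "((of_real (cos t))\<^sup>2) ^ n = complex_of_real (cos t ^ (2 * n))" for t
      by (simp add: power_mult)
    then have "(\<lambda>t. of_real (g n) * (u * v * (of_real (cos t))\<^sup>2) ^ n) = (\<lambda>t. (of_real (g n) * (u * v) ^ n) * complex_of_real (cos t ^ (2 * n)))"
      by (simp only: power_mult_distrib mult.assoc)
    moreover have "integral {0..pi} (\<lambda>t. complex_of_real (cos t ^ (2 * n))) = of_real (pi * g n)"
    proof -
      have "cosine_mean (\<lambda>x. complex_of_real (x ^ (2 * n))) = of_real (g n)"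
        by (subst cosine_mean_of_real)
           (auto intro!: continuous_intros simp: cosine_mean_even_power g_def inv_sqrt_coeff_def)
      then show ?thesis by (simp add: cosine_mean_def scaleR_conv_of_real field_simps)
    qed
    ultimately show ?thesis by (simp add: power2_eq_square)
  qed
  ultimately have "((\<lambda>n. of_real (pi * (g n)\<^sup>2) * (u * v) ^ n) has_sum
      of_real pi * cosine_mean (\<lambda>x. 1 / csqrt (1 - u * v * (of_real x)\<^sup>2))) UNIV"
    by (simp add: cosine_mean_def scaleR_conv_of_real)
  from has_sum_cmult_right[OF this, of 2] L' show ?thesis
    by (intro has_sum_unique[OF L']) (simp add: mult_ac)
qed

section \<open>A Moebius transformation with complex parameter\<close>

lemma csqrt_mult_Re_pos:
  assumes "Re z > 0" "Re w > 0"
  shows "csqrt (z * w) = csqrt z * csqrt w"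
  using Arg_Re_pos[of z] Arg_Re_pos[of w] assms by (intro csqrt_mult) auto

lemma Re_pos_not_nonpos_Reals: "Re z > 0 \<Longrightarrow> z \<notin> \<real>\<^sub>\<le>\<^sub>0"
  by (auto simp: complex_nonpos_Reals_iff)

lemma continuous_on_csqrt_Re_pos:
  assumes "continuous_on A f" "\<And>x. x \<in> A \<Longrightarrow> Re (f x) > 0"
  shows "continuous_on A (\<lambda>x. csqrt (f x))"
  by (rule continuous_on_compose2[OF continuous_on_csqrt assms(1)])
     (use assms(2) in \<open>auto dest: Re_pos_not_nonpos_Reals\<close>)

lemma csqrt_neq_0_Re_pos: "Re z > 0 \<Longrightarrow> csqrt z \<noteq> 0"
  by (metis csqrt_eq_0 order_less_irrefl zero_complex.sel(1))

text \<open>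
  An affine function that is positive at \<open>1\<close> and \<open>-1\<close> is positive in between.  The positivity of
  most radicands below is reduced in this way to the two end points.
\<close>

lemma affine_pos_on_unit_interval:
  fixes y :: real
  assumes "\<bar>y\<bar> \<le> 1" "u + v > 0" "u - v > 0"
  shows "u + v * y > 0"
proof -
  have "\<bar>v * y\<bar> \<le> \<bar>v\<bar>" using assms(1) by (simp add: abs_mult mult_left_le)
  then show ?thesis using assms(2,3) by linarith
qed

text \<open>
  The branch points \<open>1, -1, 1/l, -1/k\<close> on the left have the same cross ratio as \<open>1\<close>, \<open>-1\<close>, \<open>\<infinity>\<close> and
  the root of the radicand on the right; the Moebius map \<open>x \<mapsto> (x - l) / (1 - l x)\<close> carries one
  configuration to the other.
\<close>

lemma cosine_mean_Moebius_sqrt: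
  fixes k l :: real
  assumes k: "\<bar>k\<bar> < 1" and l: "\<bar>l\<bar> < 1"
  shows "cosine_mean (\<lambda>x. 1 / sqrt ((1 + k * x) * (1 - l * x)))
       = cosine_mean (\<lambda>y. 1 / sqrt (1 + k * l + (k + l) * y))"
proof -
  define f where "f = (\<lambda>y. 1 / sqrt (1 + k * l + (k + l) * y))"
  have pos: "1 + k * l + (k + l) * y > 0" if "\<bar>y\<bar> \<le> 1" for y
  proof (rule affine_pos_on_unit_interval[OF that])
    have "(1 + k) * (1 + l) > 0" "(1 - k) * (1 - l) > 0" using k l by auto
    then show "1 + k * l + (k + l) > 0" "1 + k * l - (k + l) > 0" by (simp_all add: algebra_simps)
  qed
  have f: "continuous_on {-1..1} f"
    unfolding f_def by (intro continuous_intros) (use pos in \<open>auto simp: abs_le_iff less_imp_neq[symmetric]\<close>)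
  have "cosine_mean f = cosine_mean (\<lambda>x. (2 * sqrt ((1 - l) * (1 + l)) / ((1 - l) * (1 + x) + (1 + l) * (1 - x))) *\<^sub>R
      f (((1 - l) * (1 + x) - (1 + l) * (1 - x)) / ((1 - l) * (1 + x) + (1 + l) * (1 - x))))"
    using l by (intro cosine_mean_Moebius[symmetric] f) auto
  also have "\<dots> = cosine_mean (\<lambda>x. 1 / sqrt ((1 + k * x) * (1 - l * x)))"
  proof (rule cosine_mean_cong)
    fix x :: real assume x: "\<bar>x\<bar> \<le> 1"
    have d: "1 - l * x > 0" using affine_pos_on_unit_interval[OF x, of 1 "-l"] l by auto
    have n: "1 + k * x > 0" using affine_pos_on_unit_interval[OF x, of 1 "k"] k by auto
    have aux: "(2 * G / (2 * d)) * (F / (G * H)) = F / (d * H)" if "G \<noteq> 0" for d F G H :: real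
      using that by simp
    have ll: "(1 - l) * (1 + l) > 0" using l by auto
    have D: "(1 - l) * (1 + x) + (1 + l) * (1 - x) = 2 * (1 - l * x)"
      and N: "(1 - l) * (1 + x) - (1 + l) * (1 - x) = 2 * (x - l)" by (simp_all add: algebra_simps)
    \<comment> \<open>the radicand on the right pulled back along the Moebius map; the factor \<open>1 - l\<^sup>2\<close> cancels against the weight\<close>
    have "1 + k * l + (k + l) * (2 * (x - l) / (2 * (1 - l * x))) = (1 - l) * (1 + l) * (1 + k * x) / (1 - l * x)"
      using d by (simp add: field_simps)
    then have "f (2 * (x - l) / (2 * (1 - l * x))) = sqrt (1 - l * x) / (sqrt ((1 - l) * (1 + l)) * sqrt (1 + k * x))"
      by (simp only: f_def real_sqrt_mult real_sqrt_divide divide_divide_eq_right mult_1)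
    then have "(2 * sqrt ((1 - l) * (1 + l)) / (2 * (1 - l * x))) * f (2 * (x - l) / (2 * (1 - l * x)))
        = (2 * sqrt ((1 - l) * (1 + l)) / (2 * (1 - l * x))) * (sqrt (1 - l * x) / (sqrt ((1 - l) * (1 + l)) * sqrt (1 + k * x)))"
      by (simp only:)
    also have "\<dots> = sqrt (1 - l * x) / ((1 - l * x) * sqrt (1 + k * x))"
      by (rule aux) (use l in auto)
    also have "\<dots> = 1 / sqrt ((1 + k * x) * (1 - l * x))"
      using real_sqrt_mult_self[of "1 - l * x"] d n by (simp add: real_sqrt_mult divide_simps)
    finally show "(2 * sqrt ((1 - l) * (1 + l)) / ((1 - l) * (1 + x) + (1 + l) * (1 - x))) *\<^sub>R
      f (((1 - l) * (1 + x) - (1 + l) * (1 - x)) / ((1 - l) * (1 + x) + (1 + l) * (1 - x))) = 1 / sqrt ((1 + k * x) * (1 - l * x))"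
      unfolding D N by simp
  qed
  finally show ?thesis by (simp add: f_def)
qed

text \<open>
  The previous identity for \<open>l = cnj k\<close>, where the Moebius map no longer preserves the interval.
  With \<open>k = x + \<i> w\<close> and \<open>l = x - \<i> w\<close> both sides are holomorphic in \<open>w\<close> on the strip
  \<open>\<bar>Im w\<bar> < 1 - \<bar>x\<bar>\<close>.  For purely imaginary \<open>w\<close> the parameters \<open>k\<close> and \<open>l\<close> are real and the previous lemma
  applies; the identity theorem carries it over to real \<open>w\<close>, where \<open>l\<close> is the conjugate of \<open>k\<close>.
\<close>

lemma cosine_mean_Moebius_csqrt:
  fixes k :: complex
  assumes k: "\<bar>Re k\<bar> < 1"
  shows "cosine_mean (\<lambda>r. 1 / (csqrt (1 + k * of_real r) * csqrt (1 - cnj k * of_real r)))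
       = of_real (cosine_mean (\<lambda>y. 1 / sqrt (1 + (norm k)\<^sup>2 + 2 * Re k * y)))"
proof -
  define x where "x = Re k"
  define S where "S = {w. Im w < 1 - \<bar>x\<bar>} \<inter> {w. - (1 - \<bar>x\<bar>) < Im w}"
  define A where "A = (\<lambda>w t. 1 + (of_real x + \<i> * w) * of_real (cos t))"
  define B where "B = (\<lambda>w t. 1 - (of_real x - \<i> * w) * of_real (cos t))"
  define P where "P = (\<lambda>(w::complex) t. of_real (1 + x\<^sup>2 + 2 * x * cos t) + w\<^sup>2)"
  have A: "Re (A w t) > 0" if "w \<in> S" for w t
  proof -
    have "1 + (x - Im w) * cos t > 0"
      by (rule affine_pos_on_unit_interval) (use that in \<open>auto simp: S_def\<close>)
    then show ?thesis by (simp add: A_def algebra_simps)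
  qed
  have B: "Re (B w t) > 0" if "w \<in> S" for w t
  proof -
    have "1 + (- x - Im w) * cos t > 0"
      by (rule affine_pos_on_unit_interval) (use that in \<open>auto simp: S_def\<close>)
    then show ?thesis by (simp add: B_def algebra_simps)
  qed
  have P: "Re (P w t) > 0" if "w \<in> S" for w t
  proof -
    have "\<bar>Im w\<bar>\<^sup>2 < (1 - \<bar>x\<bar>)\<^sup>2" using that by (intro power_strict_mono) (auto simp: S_def)
    then have "(Im w)\<^sup>2 < 1 + x\<^sup>2 - 2 * x" "(Im w)\<^sup>2 < 1 + x\<^sup>2 + 2 * x"
      by (auto simp: power2_eq_square algebra_simps abs_if split: if_splits)
    then have "(1 + x\<^sup>2 - (Im w)\<^sup>2) + 2 * x * cos t > 0"
      by (intro affine_pos_on_unit_interval[of "cos t" "1 + x\<^sup>2 - (Im w)\<^sup>2" "2 * x"]) auto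
    moreover have "0 \<le> (Re w)\<^sup>2" by simp
    moreover have "Re (P w t) = 1 + x\<^sup>2 + 2 * x * cos t + ((Re w)\<^sup>2 - (Im w)\<^sup>2)"
      by (simp add: P_def power2_eq_square)
    ultimately show ?thesis by linarith
  qed
  note nz = A[THEN csqrt_neq_0_Re_pos] B[THEN csqrt_neq_0_Re_pos] P[THEN csqrt_neq_0_Re_pos]
  note np = A[THEN Re_pos_not_nonpos_Reals] B[THEN Re_pos_not_nonpos_Reals] P[THEN Re_pos_not_nonpos_Reals]
  define L where "L = (\<lambda>w. integral (cbox 0 pi) (\<lambda>t. 1 / (csqrt (A w t) * csqrt (B w t))))"
  define R where "R = (\<lambda>w. integral (cbox 0 pi) (\<lambda>t. 1 / csqrt (P w t)))"
  have conv: "convex S"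
    unfolding S_def by (intro convex_Int convex_halfspace_Im_lt convex_halfspace_Im_gt)
  have contA: "continuous_on (S \<times> T) (\<lambda>z. csqrt (A (fst z) (snd z)))" for T
    by (rule continuous_on_csqrt_Re_pos) (use A in \<open>auto simp: A_def intro!: continuous_intros\<close>)
  have contB: "continuous_on (S \<times> T) (\<lambda>z. csqrt (B (fst z) (snd z)))" for T
    by (rule continuous_on_csqrt_Re_pos) (use B in \<open>auto simp: B_def intro!: continuous_intros\<close>)
  have contP: "continuous_on (S \<times> T) (\<lambda>z. csqrt (P (fst z) (snd z)))" for T
    by (rule continuous_on_csqrt_Re_pos) (use P in \<open>auto simp: P_def intro!: continuous_intros\<close>)
  have cA: "continuous_on T (\<lambda>t. csqrt (A w t))" if "w \<in> S" for w T
    by (rule continuous_on_csqrt_Re_pos) (use A[OF that] in \<open>auto simp: A_def intro!: continuous_intros\<close>)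
  have cB: "continuous_on T (\<lambda>t. csqrt (B w t))" if "w \<in> S" for w T
    by (rule continuous_on_csqrt_Re_pos) (use B[OF that] in \<open>auto simp: B_def intro!: continuous_intros\<close>)
  have cP: "continuous_on T (\<lambda>t. csqrt (P w t))" if "w \<in> S" for w T
    by (rule continuous_on_csqrt_Re_pos) (use P[OF that] in \<open>auto simp: P_def intro!: continuous_intros\<close>)
  have "L holomorphic_on S"
    unfolding L_def
  proof (rule leibniz_rule_holomorphic[OF _ _ _ conv])
    show "((\<lambda>w. 1 / (csqrt (A w t) * csqrt (B w t))) has_field_derivative
        - (\<i> * of_real (cos t) / (2 * csqrt (A w t)) * csqrt (B w t) + \<i> * of_real (cos t) / (2 * csqrt (B w t)) * csqrt (A w t))
          / (csqrt (A w t) * csqrt (B w t))\<^sup>2) (at w within S)" if "w \<in> S" for w t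
    proof -
      have "((\<lambda>w. A w t) has_field_derivative \<i> * of_real (cos t)) (at w within S)"
        "((\<lambda>w. B w t) has_field_derivative \<i> * of_real (cos t)) (at w within S)"
        unfolding A_def B_def by (auto intro!: derivative_eq_intros)
      note D = this this[THEN has_field_derivative_csqrt']
      show ?thesis
        using nz[OF that] np[OF that]
        by (auto intro!: derivative_eq_intros D simp: power2_eq_square)
    qed
    show "(\<lambda>t. 1 / (csqrt (A w t) * csqrt (B w t))) integrable_on cbox 0 pi" if "w \<in> S" for w
      by (intro integrable_continuous continuous_intros cA cB that) (use nz[OF that] in auto)
    show "continuous_on (S \<times> cbox 0 pi) (\<lambda>(w, t).
        - (\<i> * of_real (cos t) / (2 * csqrt (A w t)) * csqrt (B w t) + \<i> * of_real (cos t) / (2 * csqrt (B w t)) * csqrt (A w t))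
          / (csqrt (A w t) * csqrt (B w t))\<^sup>2)"
      unfolding split_def by (intro continuous_intros contA contB) (use nz in auto)
  qed
  moreover have "R holomorphic_on S"
    unfolding R_def
  proof (rule leibniz_rule_holomorphic[OF _ _ _ conv])
    show "((\<lambda>w. 1 / csqrt (P w t)) has_field_derivative - (2 * w / (2 * csqrt (P w t))) / (csqrt (P w t))\<^sup>2) (at w within S)"
      if "w \<in> S" for w t
    proof -
      have "((\<lambda>w. P w t) has_field_derivative 2 * w) (at w within S)"
        unfolding P_def by (auto intro!: derivative_eq_intros)
      note D = this this[THEN has_field_derivative_csqrt']
      show ?thesis
        using nz[OF that] np[OF that]
        by (auto intro!: derivative_eq_intros D simp: power2_eq_square)
    qed
    show "(\<lambda>t. 1 / csqrt (P w t)) integrable_on cbox 0 pi" if "w \<in> S" for w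
      by (intro integrable_continuous continuous_intros cP that) (use nz[OF that] in auto)
    show "continuous_on (S \<times> cbox 0 pi) (\<lambda>(w, t). - (2 * w / (2 * csqrt (P w t))) / (csqrt (P w t))\<^sup>2)"
      unfolding split_def by (intro continuous_intros contP) (use nz in auto)
  qed
  ultimately have hol: "(\<lambda>w. L w - R w) holomorphic_on S" by (intro holomorphic_intros)
  \<comment> \<open>the imaginary segment on which both parameters are real\<close>
  define U where "U = (\<lambda>h. \<i> * complex_of_real h) ` {-(1 - \<bar>x\<bar>)<..<1 - \<bar>x\<bar>}"
  \<comment> \<open>for \<open>w = \<i> h\<close> the parameters are \<open>k = x - h\<close> and \<open>l = x + h\<close>\<close>
  have LR: "L w - R w = 0" if "w \<in> U" for w
  proof -
    from that obtain h where h: "w = \<i> * of_real h" "\<bar>h\<bar> < 1 - \<bar>x\<bar>" by (auto simp: U_def abs_less_iff)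
    have kl: "\<bar>x - h\<bar> < 1" "\<bar>x + h\<bar> < 1" using h by auto
    have wS: "w \<in> S" using h by (auto simp: S_def)
    have "A w t = of_real (1 + (x - h) * cos t)" "B w t = of_real (1 - (x + h) * cos t)" 
      "P w t = of_real (1 + (x - h) * (x + h) + (x - h + (x + h)) * cos t)" for t
      by (simp_all add: A_def B_def P_def h complex_eq_iff power2_eq_square algebra_simps)
    note eqs = this
    have pos: "1 + (x - h) * cos t > 0" "1 - (x + h) * cos t > 0"
       "1 + (x - h) * (x + h) + (x - h + (x + h)) * cos t > 0" for t
      using A[OF wS, of t] B[OF wS, of t] P[OF wS, of t] unfolding eqs Re_complex_of_real by auto
    have "L w = pi * cosine_mean (\<lambda>r. complex_of_real (1 / sqrt ((1 + (x - h) * r) * (1 - (x + h) * r))))"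
      using pos by (simp add: L_def eqs cosine_mean_def real_sqrt_mult scaleR_conv_of_real less_imp_le flip: of_real_sqrt)
    also have "\<dots> = pi * complex_of_real (cosine_mean (\<lambda>r. 1 / sqrt ((1 + (x - h) * r) * (1 - (x + h) * r))))"
    proof (subst cosine_mean_of_real)
      have "1 + (x - h) * r > 0" "1 - (x + h) * r > 0" if "-1 \<le> r" "r \<le> 1" for r
        using pos[of "arccos r"] that by simp_all
      then show "continuous_on {-1..1} (\<lambda>r. 1 / sqrt ((1 + (x - h) * r) * (1 - (x + h) * r)))"
        by (intro continuous_intros) (auto simp: less_imp_neq[symmetric])
    qed simp
    also have "\<dots> = pi * complex_of_real (cosine_mean (\<lambda>y. 1 / sqrt (1 + (x - h) * (x + h) + (x - h + (x + h)) * y)))"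
      by (subst cosine_mean_Moebius_sqrt[OF kl]) simp
    also have "\<dots> = pi * cosine_mean (\<lambda>y. complex_of_real (1 / sqrt (1 + (x - h) * (x + h) + (x - h + (x + h)) * y)))"
    proof (subst cosine_mean_of_real)
      have "1 + (x - h) * (x + h) + (x - h + (x + h)) * r > 0" if "-1 \<le> r" "r \<le> 1" for r
        using pos(3)[of "arccos r"] that by simp
      then show "continuous_on {-1..1} (\<lambda>y. 1 / sqrt (1 + (x - h) * (x + h) + (x - h + (x + h)) * y))"
        by (intro continuous_intros) (auto simp: less_imp_neq[symmetric])
    qed simp
    also have "\<dots> = R w"
      using pos unfolding R_def eqs by (simp add: cosine_mean_def scaleR_conv_of_real less_imp_le flip: of_real_sqrt)
    finally show ?thesis by simp
  qed
  have "L (of_real (Im k)) - R (of_real (Im k)) = 0"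
  proof (rule analytic_continuation[OF hol, where U = U and \<xi> = 0])
    show "open S" unfolding S_def by (intro open_Int open_halfspace_Im_lt open_halfspace_Im_gt)
    show "connected S" using conv by (rule convex_connected)
    show "U \<subseteq> S" by (auto simp: U_def S_def)
    show "0 \<in> S" "complex_of_real (Im k) \<in> S" using k by (auto simp: S_def x_def)
    show "0 islimpt U"
      unfolding islimpt_approachable
    proof (intro allI impI)
      fix e :: real assume e: "e > 0"
      define h where "h = min (e / 2) ((1 - \<bar>x\<bar>) / 2)"
      have h: "0 < h" "h < e" "h < 1 - \<bar>x\<bar>" using e k by (auto simp: h_def x_def min_def)
      then show "\<exists>w\<in>U. w \<noteq> 0 \<and> dist w 0 < e"
        by (intro bexI[of _ "\<i> * of_real h"]) (auto simp: U_def norm_mult)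
    qed
  qed (use LR in auto)
  then have eq: "L (of_real (Im k)) = R (of_real (Im k))" by simp
  have kx: "of_real x + \<i> * of_real (Im k) = k" "of_real x - \<i> * of_real (Im k) = cnj k"
    by (simp_all add: complex_eq_iff x_def)
  have "L (of_real (Im k)) = pi * cosine_mean (\<lambda>r. 1 / (csqrt (1 + k * of_real r) * csqrt (1 - cnj k * of_real r)))"
    by (simp add: L_def A_def B_def kx cosine_mean_def scaleR_conv_of_real)
  moreover have "R (of_real (Im k)) = pi * of_real (cosine_mean (\<lambda>y. 1 / sqrt (1 + (norm k)\<^sup>2 + 2 * Re k * y)))"
  proof -
    have Pk: "P (of_real (Im k)) t = of_real (1 + (norm k)\<^sup>2 + 2 * Re k * cos t)" for t
      by (simp add: P_def x_def cmod_power2 complex_eq_iff algebra_simps)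
    have pos: "1 + (norm k)\<^sup>2 + 2 * Re k * cos t > 0" for t
      using P[of "of_real (Im k)" t] k unfolding Pk Re_complex_of_real by (auto simp: S_def x_def)
    have "R (of_real (Im k)) = pi * cosine_mean (\<lambda>y. complex_of_real (1 / sqrt (1 + (norm k)\<^sup>2 + 2 * Re k * y)))"
      using pos unfolding R_def Pk by (simp add: cosine_mean_def scaleR_conv_of_real less_imp_le flip: of_real_sqrt)
    also have "\<dots> = pi * of_real (cosine_mean (\<lambda>y. 1 / sqrt (1 + (norm k)\<^sup>2 + 2 * Re k * y)))"
    proof (subst cosine_mean_of_real)
      have "1 + (norm k)\<^sup>2 + 2 * Re k * r > 0" if "-1 \<le> r" "r \<le> 1" for r
        using pos[of "arccos r"] that by simp
      then show "continuous_on {-1..1} (\<lambda>y. 1 / sqrt (1 + (norm k)\<^sup>2 + 2 * Re k * y))"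
        by (intro continuous_intros) (auto simp: less_imp_neq[symmetric])
    qed simp
    finally show ?thesis .
  qed
  ultimately show ?thesis using eq by simp
qed

text \<open>
  The homogeneous form of the Landen transformation.
\<close>

lemma circle_integral_affine_factors:
  fixes p q p' q' :: real
  assumes q: "\<bar>q\<bar> < p" and q': "\<bar>q'\<bar> < p'"
  shows "integral {- pi..pi} (\<lambda>t. 1 / (csqrt (p + q * cis t) * csqrt (p' + q' * cis (- t))))
       = complex_of_real (2 * pi * cosine_mean (\<lambda>s. 1 / sqrt (p * p' - q * q' * s\<^sup>2)))"
proof -
  define u v where "u = q / p" and "v = q' / p'"
  have p: "p > 0" "p' > 0" using q q' by auto
  have u: "\<bar>u\<bar> < 1" and v: "\<bar>v\<bar> < 1" using q q' p by (simp_all add: u_def v_def)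
  have fac: "csqrt (of_real p + of_real q * cis t) = of_real (sqrt p) * csqrt (1 + of_real u * cis t)"
    if "p > 0" "u = q / p" "\<bar>u\<bar> < 1" for p q u t
  proof -
    have "1 + u * cos t > 0"
      by (rule affine_pos_on_unit_interval) (use that(3) in auto)
    then have "Re (1 + of_real u * cis t) > 0" by simp
    then have "csqrt (of_real p * (1 + of_real u * cis t)) = csqrt (of_real p) * csqrt (1 + of_real u * cis t)"
      using that by (intro csqrt_mult_Re_pos) auto
    moreover have "of_real p * (1 + of_real u * cis t) = of_real p + of_real q * cis t"
      using that by (simp add: algebra_simps)
    ultimately show ?thesis using that by simp
  qed
  have uvs: "1 - u * v * s\<^sup>2 > 0" if "\<bar>s\<bar> \<le> 1" for s
  proof -
    have "\<bar>u\<bar> * \<bar>v\<bar> < 1 * 1" using u v by (intro mult_strict_mono) auto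
    then have "\<bar>u * v\<bar> * s\<^sup>2 < 1" using that
      by (intro le_less_trans[of "\<bar>u * v\<bar> * s\<^sup>2" "\<bar>u * v\<bar>"] mult_left_le) (auto simp: abs_mult abs_square_le_1)
    then have "\<bar>u * v * s\<^sup>2\<bar> < 1" by (simp add: abs_mult)
    then show ?thesis by (simp add: abs_less_iff)
  qed
  have "integral {- pi..pi} (\<lambda>t. 1 / (csqrt (p + q * cis t) * csqrt (p' + q' * cis (- t))))
      = integral {- pi..pi} (\<lambda>t. 1 / (sqrt p * sqrt p') * (1 / (csqrt (1 + of_real u * cis t) * csqrt (1 + of_real v * cis (- t)))))"
    using p u v by (intro Henstock_Kurzweil_Integration.integral_cong) (simp add: fac[of p u q] fac[of p' v q'] u_def v_def)
  also have "\<dots> = 1 / (sqrt p * sqrt p') * (2 * pi * cosine_mean (\<lambda>x. 1 / csqrt (1 - of_real u * of_real v * (of_real x)\<^sup>2)))"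
    unfolding integral_mult_right using u v by (subst circle_integral_inv_csqrt_factors) auto
  also have "cosine_mean (\<lambda>x. 1 / csqrt (1 - of_real u * of_real v * (of_real x)\<^sup>2))
      = cosine_mean (\<lambda>x. complex_of_real (1 / sqrt (1 - u * v * x\<^sup>2)))"
  proof (rule cosine_mean_cong)
    fix x :: real assume "\<bar>x\<bar> \<le> 1"
    then have "complex_of_real (sqrt (1 - u * v * x\<^sup>2)) = csqrt (of_real (1 - u * v * x\<^sup>2))"
      using uvs[of x] by (intro of_real_sqrt) simp
    then show "1 / csqrt (1 - of_real u * of_real v * (of_real x)\<^sup>2) = complex_of_real (1 / sqrt (1 - u * v * x\<^sup>2))"
      by simp
  qed
  also have "\<dots> = of_real (cosine_mean (\<lambda>x. 1 / sqrt (1 - u * v * x\<^sup>2)))"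
    by (intro cosine_mean_of_real continuous_intros) (use uvs in \<open>auto simp: abs_le_iff less_imp_neq[symmetric]\<close>)
  also have "1 / (sqrt p * sqrt p') * (2 * pi * complex_of_real (cosine_mean (\<lambda>x. 1 / sqrt (1 - u * v * x\<^sup>2))))
      = complex_of_real (2 * pi * cosine_mean (\<lambda>x. 1 / (sqrt p * sqrt p') * (1 / sqrt (1 - u * v * x\<^sup>2))))"
    unfolding cosine_mean_mult_left by simp
  also have "cosine_mean (\<lambda>x. 1 / (sqrt p * sqrt p') * (1 / sqrt (1 - u * v * x\<^sup>2))) = cosine_mean (\<lambda>s. 1 / sqrt (p * p' - q * q' * s\<^sup>2))"
  proof -
    have "p * p' - q * q' * s\<^sup>2 = p * p' * (1 - u * v * s\<^sup>2)" for s
      using p by (simp add: u_def v_def field_simps)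
    then show ?thesis by (simp add: real_sqrt_mult)
  qed
  finally show ?thesis .
qed

text \<open>
  The homogeneous form of the complex Moebius identity, with \<open>k = B / A\<close>.
\<close>

lemma cosine_mean_conjugate_factors:
  fixes A B :: complex
  assumes A: "Re A > 0" and B: "norm B < norm A"
  shows "cosine_mean (\<lambda>r. 1 / (csqrt (A + of_real r * B) * csqrt (cnj A - of_real r * cnj B)))
       = of_real (cosine_mean (\<lambda>y. 1 / sqrt ((norm A)\<^sup>2 + (norm B)\<^sup>2 + 2 * Re (A * cnj B) * y)))"
proof -
  define k where "k = B / A"
  have A0: "norm A > 0" "A \<noteq> 0" using A by auto
  have k: "norm k < 1" using A0 B by (simp add: k_def norm_divide)
  then have Rek: "\<bar>Re k\<bar> < 1" using abs_Re_le_cmod[of k] by linarith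
  have AA: "csqrt A * csqrt (cnj A) = of_real (norm A)"
  proof -
    have "csqrt A * csqrt (cnj A) = csqrt (A * cnj A)" using A by (intro csqrt_mult_Re_pos[symmetric]) auto
    also have "A * cnj A = of_real ((norm A)\<^sup>2)" by (simp only: complex_norm_square)
    also have "csqrt \<dots> = of_real (sqrt ((norm A)\<^sup>2))" by (rule of_real_sqrt[symmetric]) simp
    finally show ?thesis by simp
  qed
  have "cosine_mean (\<lambda>r. 1 / (csqrt (A + of_real r * B) * csqrt (cnj A - of_real r * cnj B)))
      = cosine_mean (\<lambda>r. (1 / norm A) *\<^sub>R (1 / (csqrt (1 + k * of_real r) * csqrt (1 - cnj k * of_real r))))"
  proof (rule cosine_mean_cong)
    fix r :: real assume r: "\<bar>r\<bar> \<le> 1"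
    have "Re (1 + k * of_real r) > 0" "Re (1 - cnj k * of_real r) > 0"
      using affine_pos_on_unit_interval[OF r, of 1 "Re k"] affine_pos_on_unit_interval[OF r, of 1 "- Re k"] Rek by auto
    then have "csqrt (A * (1 + k * of_real r)) * csqrt (cnj A * (1 - cnj k * of_real r))
        = (csqrt A * csqrt (cnj A)) * (csqrt (1 + k * of_real r) * csqrt (1 - cnj k * of_real r))"
      using A by (simp add: csqrt_mult_Re_pos)
    moreover have "A * (1 + k * of_real r) = A + of_real r * B" "cnj A * (1 - cnj k * of_real r) = cnj A - of_real r * cnj B"
      using A0 by (simp_all add: k_def algebra_simps)
    ultimately show "1 / (csqrt (A + of_real r * B) * csqrt (cnj A - of_real r * cnj B))
       = (1 / norm A) *\<^sub>R (1 / (csqrt (1 + k * of_real r) * csqrt (1 - cnj k * of_real r)))"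
      by (simp add: AA scaleR_conv_of_real)
  qed
  also have "\<dots> = (1 / norm A) *\<^sub>R complex_of_real (cosine_mean (\<lambda>y. 1 / sqrt (1 + (norm k)\<^sup>2 + 2 * Re k * y)))"
    unfolding cosine_mean_scaleR cosine_mean_Moebius_csqrt[OF Rek] ..
  also have "\<dots> = of_real (cosine_mean (\<lambda>y. (1 / norm A) * (1 / sqrt (1 + (norm k)\<^sup>2 + 2 * Re k * y))))"
    unfolding cosine_mean_mult_left by (simp add: scaleR_conv_of_real)
  also have "(\<lambda>y. (1 / norm A) * (1 / sqrt (1 + (norm k)\<^sup>2 + 2 * Re k * y)))
      = (\<lambda>y. 1 / sqrt ((norm A)\<^sup>2 + (norm B)\<^sup>2 + 2 * Re (A * cnj B) * y))"
  proof
    fix y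
    have "B * cnj A = k * of_real ((norm A)\<^sup>2)"
      using A0 by (simp add: k_def complex_norm_square del: of_real_power)
    then have "Re (B * cnj A) = Re k * (norm A)\<^sup>2" by (simp del: of_real_power complex_mult_cnj)
    moreover have "Re (A * cnj B) = Re (B * cnj A)" by simp
    moreover have "norm B = norm A * norm k" using A0 by (simp add: k_def norm_divide)
    ultimately have "(norm A)\<^sup>2 + (norm B)\<^sup>2 + 2 * Re (A * cnj B) * y = (norm A)\<^sup>2 * (1 + (norm k)\<^sup>2 + 2 * Re k * y)"
      by (simp only: power_mult_distrib) (simp add: algebra_simps)
    then show "(1 / norm A) * (1 / sqrt (1 + (norm k)\<^sup>2 + 2 * Re k * y)) = 1 / sqrt ((norm A)\<^sup>2 + (norm B)\<^sup>2 + 2 * Re (A * cnj B) * y)"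
      by (simp add: real_sqrt_mult)
  qed
  finally show ?thesis .
qed

section \<open>The torus mean and its invariance\<close>

text \<open>
  With \<open>x = cos (2 \<theta>)\<close> and \<open>y = cos (2 \<phi>)\<close> this is
  \<open>c\<^sub>1\<^sup>2 cos\<^sup>2 \<theta> cos\<^sup>2 \<phi> + c\<^sub>2\<^sup>2 cos\<^sup>2 \<theta> sin\<^sup>2 \<phi> + c\<^sub>3\<^sup>2 sin\<^sup>2 \<theta> cos\<^sup>2 \<phi> + c\<^sub>4\<^sup>2 sin\<^sup>2 \<theta> sin\<^sup>2 \<phi>\<close>,
  a convex combination of the four squares.
\<close>

definition quad_form :: "real^4 \<Rightarrow> real \<Rightarrow> real \<Rightarrow> real" where
  "quad_form c x y = ((c$1)\<^sup>2 * ((1 + x) * (1 + y)) + (c$2)\<^sup>2 * ((1 + x) * (1 - y))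
     + (c$3)\<^sup>2 * ((1 - x) * (1 + y)) + (c$4)\<^sup>2 * ((1 - x) * (1 - y))) / 4"

text \<open>
  The analogue of Gauss's complete elliptic integral: for positive \<open>c\<^sub>1 = c\<^sub>2\<close> and \<open>c\<^sub>3 = c\<^sub>4\<close> it is the
  reciprocal of the arithmetic-geometric mean of \<open>c\<^sub>1\<close> and \<open>c\<^sub>3\<close>.
\<close>

definition torus_mean :: "real^4 \<Rightarrow> real" where
  "torus_mean c = cosine_mean (\<lambda>x. cosine_mean (\<lambda>y. 1 / sqrt (quad_form c x y)))"

lemma quad_form_bounds:
  assumes "\<bar>x\<bar> \<le> 1" "\<bar>y\<bar> \<le> 1" "0 \<le> lo" "\<And>i. lo \<le> c$i" "\<And>i. c$i \<le> hi"
  shows "lo\<^sup>2 \<le> quad_form c x y" "quad_form c x y \<le> hi\<^sup>2"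
proof -
  have w: "0 \<le> (1 + x) * (1 + y)" "0 \<le> (1 + x) * (1 - y)" "0 \<le> (1 - x) * (1 + y)" "0 \<le> (1 - x) * (1 - y)"
    using assms(1,2) by (auto simp: abs_le_iff)
  have one: "k = (k * ((1 + x) * (1 + y)) + k * ((1 + x) * (1 - y)) + k * ((1 - x) * (1 + y)) + k * ((1 - x) * (1 - y))) / 4" for k
    by (simp add: algebra_simps)
  have lo: "lo\<^sup>2 \<le> (c$i)\<^sup>2" and hi: "(c$i)\<^sup>2 \<le> hi\<^sup>2" for i
    using assms(3) assms(4,5)[of i] by (auto intro: power_mono)
  show "lo\<^sup>2 \<le> quad_form c x y"
    unfolding quad_form_def by (subst one) (intro divide_right_mono add_mono mult_right_mono lo w; simp)
  show "quad_form c x y \<le> hi\<^sup>2"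
    unfolding quad_form_def by (subst (2) one) (intro divide_right_mono add_mono mult_right_mono hi w; simp)
qed

lemma quad_form_pos:
  assumes c: "\<And>i. c$i > 0" and "\<bar>x\<bar> \<le> 1" "\<bar>y\<bar> \<le> 1"
  shows "quad_form c x y > 0"
proof -
  define lo where "lo = Min (range (($) c))"
  define hi where "hi = Max (range (($) c))"
  have "lo > 0" "\<And>i. lo \<le> c$i" "\<And>i. c$i \<le> hi" using c by (auto simp: lo_def hi_def)
  then have "0 < lo\<^sup>2" "lo\<^sup>2 \<le> quad_form c x y" using quad_form_bounds(1)[OF assms(2,3), of lo c hi] by auto
  then show ?thesis by linarith
qed

lemma continuous_on_inverse_sqrt_quad_form:
  assumes "\<And>i. c$i > 0"
  shows "continuous_on ({-1..1} \<times> {-1..1}) (\<lambda>(x, y). 1 / sqrt (quad_form c x y))"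
proof -
  have "quad_form c (fst p) (snd p) \<noteq> 0" if "p \<in> {-1..1} \<times> {-1..1}" for p
    using quad_form_pos[OF assms, of "fst p" "snd p"] that by (auto simp: abs_le_iff)
  then show ?thesis
    unfolding split_def by (intro continuous_intros) (auto simp: quad_form_def intro!: continuous_intros)
qed

lemma m_component [simp]:
  "m u $ 1 = (u$1 + u$2 + u$3 + u$4) / 4"
  "m u $ 2 = sqrt ((u$1 + u$3) * (u$2 + u$4)) / 2"
  "m u $ 3 = sqrt ((u$1 + u$2) * (u$3 + u$4)) / 2"
  "m u $ 4 = sqrt ((u$1 * u$4 + u$2 * u$3) / 2)"
  by (simp_all add: m_def vector_def)

lemma m_pos:
  assumes "\<And>i. u$i > 0"
  shows "m u $ i > 0"
  using assms exhaust_4[of i] by (auto intro!: add_pos_pos mult_pos_pos divide_pos_pos)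

text \<open>
  Let \<open>a\<^sub>0, \<dots>, a\<^sub>3\<close> be a quarter of the Hadamard transform of \<open>c\<close>.  The form of \<open>m c\<close> depends
  on the squares of the \<open>a\<^sub>i\<close> only, namely it is
  \<open>a\<^sub>0\<^sup>2 - a\<^sub>1\<^sup>2 X - a\<^sub>2\<^sup>2 Y + a\<^sub>3\<^sup>2 X Y\<close> with \<open>X\<close> and \<open>Y\<close> squares of cosines, \<open>X = r\<^sup>2\<close> and \<open>Y = s\<^sup>2\<close>.
  For fixed \<open>r\<close> it equals \<open>(a\<^sub>0 + r a\<^sub>1) (a\<^sub>0 - r a\<^sub>1) - (a\<^sub>2 + r a\<^sub>3) (a\<^sub>2 - r a\<^sub>3) s\<^sup>2\<close>, so the
  Landen transformation turns the mean over \<open>s\<close> into a circle integral of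
  \<open>1 / (csqrt (A + r B) * csqrt (cnj A - r cnj B))\<close> with \<open>A = a\<^sub>0 + a\<^sub>2 cis t\<close> and \<open>B = a\<^sub>1 + a\<^sub>3 cis t\<close>.
  Now fix \<open>t\<close> instead and take the mean over \<open>r\<close>: the Moebius identity produces the
  radicand \<open>\<bar>A\<bar>\<^sup>2 + \<bar>B\<bar>\<^sup>2 + 2 Re (A cnj B) y\<close>, which is the form of \<open>c\<close> at \<open>x = cos t\<close>.
\<close>

theorem torus_mean_m:
  assumes c: "\<And>i. c$i > 0"
  shows "torus_mean (m c) = torus_mean c"
proof -
  define a0 a1 a2 a3 where "a0 = (c$1 + c$2 + c$3 + c$4) / 4" and "a1 = (c$1 - c$2 + c$3 - c$4) / 4"
    and "a2 = (c$1 + c$2 - c$3 - c$4) / 4" and "a3 = (c$1 - c$2 - c$3 + c$4) / 4"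
  define Q where "Q = (\<lambda>X Y. a0\<^sup>2 - a1\<^sup>2 * X - a2\<^sup>2 * Y + a3\<^sup>2 * X * Y)"
  define A where "A = (\<lambda>t. of_real a0 + of_real a2 * cis t)"
  define B where "B = (\<lambda>t. of_real a1 + of_real a3 * cis t)"
  have Qm: "quad_form (m c) x y = Q ((1 - y) / 2) ((1 - x) / 2)" for x y
  proof -
    have "(m c $ 2)\<^sup>2 = (c$1 + c$3) * (c$2 + c$4) / 4" "(m c $ 3)\<^sup>2 = (c$1 + c$2) * (c$3 + c$4) / 4"
      "(m c $ 4)\<^sup>2 = (c$1 * c$4 + c$2 * c$3) / 2"
      using c by (simp_all add: power_divide less_imp_le add_pos_pos)
    then show ?thesis
      unfolding quad_form_def Q_def a0_def a1_def a2_def a3_def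
      by (simp add: power2_eq_square field_simps)
  qed
  have Qpos: "Q X Y > 0" if "0 \<le> X" "X \<le> 1" "0 \<le> Y" "Y \<le> 1" for X Y
    using quad_form_pos[OF m_pos[OF c], of "1 - 2 * Y" "1 - 2 * X"] that by (simp add: Qm abs_le_iff)
  have contQ: "continuous_on ({0..1} \<times> {0..1}) (\<lambda>(X, Y). 1 / sqrt (Q X Y))"
  proof -
    have "Q (fst p) (snd p) \<noteq> 0" if "p \<in> {0..1} \<times> {0..1}" for p
      using Qpos[of "fst p" "snd p"] that by (auto simp: less_imp_neq[symmetric])
    then show ?thesis
      unfolding split_def by (intro continuous_intros) (auto simp: Q_def intro!: continuous_intros)
  qed
  have contQ': "continuous_on ({-1..1} \<times> {0..1}) (\<lambda>(r, Y). 1 / sqrt (Q (r\<^sup>2) Y))"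
    unfolding split_def
    by (rule continuous_on_compose2[OF contQ, of _ "\<lambda>p. ((fst p)\<^sup>2, snd p)", simplified])
       (auto intro!: continuous_intros simp: abs_square_le_1)
  have lin: "\<bar>a2 + r * a3\<bar> < a0 + r * a1" if "\<bar>r\<bar> \<le> 1" for r
  proof -
    \<comment> \<open>the sum and the difference of the two sides, written in terms of \<open>c\<close>\<close>
    have "(c$1 + c$2) / 2 + (c$1 - c$2) / 2 * r > 0" "(c$3 + c$4) / 2 + (c$3 - c$4) / 2 * r > 0"
      using affine_pos_on_unit_interval[OF that, of "(c$1 + c$2) / 2" "(c$1 - c$2) / 2"]
        affine_pos_on_unit_interval[OF that, of "(c$3 + c$4) / 2" "(c$3 - c$4) / 2"] c by (auto simp: field_simps)
    then show ?thesis
      by (simp add: abs_less_iff a0_def a1_def a2_def a3_def algebra_simps) (simp add: field_simps)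
  qed
  have ReAB: "Re (A t + of_real r * B t) > 0" if "\<bar>r\<bar> \<le> 1" for r t
  proof -
    have "(a0 + r * a1) + (a2 + r * a3) * cos t > 0"
      using lin[OF that] by (intro affine_pos_on_unit_interval) auto
    then show ?thesis by (simp add: A_def B_def algebra_simps)
  qed
  have ReAB': "Re (cnj (A t) - of_real r * cnj (B t)) > 0" if "\<bar>r\<bar> \<le> 1" for r t
    using ReAB[of "- r" t] that by simp
  have ReA: "Re (A t) > 0" for t using ReAB[of 0 t] by simp
  have norm_affine: "(norm (of_real p + of_real q * cis t))\<^sup>2 = p\<^sup>2 + q\<^sup>2 + 2 * p * q * cos t" for p q t
  proof -
    have "(p + q * C)\<^sup>2 + (q * S)\<^sup>2 = p\<^sup>2 + q\<^sup>2 * (C\<^sup>2 + S\<^sup>2) + 2 * p * q * C" for C S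
      by (simp add: power2_eq_square algebra_simps)
    from this[of "cos t" "sin t"] show ?thesis by (simp add: cmod_power2)
  qed
  have quad: "quad_form c (cos t) y = (norm (A t))\<^sup>2 + (norm (B t))\<^sup>2 + 2 * Re (A t * cnj (B t)) * y" for t y
  proof -
    have "(a0 + a2 * C) * (a1 + a3 * C) + a2 * S * (a3 * S) = a0 * a1 + a2 * a3 * (C\<^sup>2 + S\<^sup>2) + (a0 * a3 + a1 * a2) * C" for C S
      by (simp add: power2_eq_square algebra_simps)
    from this[of "cos t" "sin t"] have "Re (A t * cnj (B t)) = a0 * a1 + a2 * a3 + (a0 * a3 + a1 * a2) * cos t"
      by (simp add: A_def B_def)
    then show ?thesis
      unfolding quad_form_def unfolding A_def B_def norm_affine
      by (simp add: a0_def a1_def a2_def a3_def power2_eq_square) (simp add: field_simps)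
  qed
  have BA: "norm (B t) < norm (A t)" for t
  proof -
    \<comment> \<open>at \<open>cos t = 1\<close> and \<open>cos t = -1\<close> the difference of the squares is \<open>c\<^sub>1 c\<^sub>2\<close> and \<open>c\<^sub>3 c\<^sub>4\<close>\<close>
    define U V where "U = (c$1 * c$2 + c$3 * c$4) / 2" and "V = (c$1 * c$2 - c$3 * c$4) / 2"
    have "(norm (A t))\<^sup>2 - (norm (B t))\<^sup>2 = U + V * cos t"
      unfolding A_def B_def norm_affine
      by (simp add: U_def V_def a0_def a1_def a2_def a3_def power2_eq_square) (simp add: field_simps)
    also have "\<dots> > 0"
      by (rule affine_pos_on_unit_interval) (use c in \<open>auto simp: U_def V_def field_simps\<close>)
    finally show ?thesis by (simp add: power2_less_imp_less)
  qed
  have contH: "continuous_on ({-1..1} \<times> {- pi..pi})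
      (\<lambda>(r, t). 1 / (csqrt (A t + of_real r * B t) * csqrt (cnj (A t) - of_real r * cnj (B t))))"
  proof -
    let ?S = "{-1..1} \<times> {- pi..pi}"
    have AB: "continuous_on T (\<lambda>p. A (snd p))" "continuous_on T (\<lambda>p. B (snd p))" for T :: "(real \<times> real) set"
      unfolding A_def B_def by (auto intro!: continuous_intros)
    have "continuous_on ?S (\<lambda>p. csqrt (A (snd p) + of_real (fst p) * B (snd p)))"
      using ReAB by (intro continuous_on_csqrt_Re_pos continuous_intros AB) (simp add: abs_le_iff mem_Times_iff)
    moreover have "continuous_on ?S (\<lambda>p. csqrt (cnj (A (snd p)) - of_real (fst p) * cnj (B (snd p))))"
      using ReAB' by (intro continuous_on_csqrt_Re_pos continuous_intros AB) (simp add: abs_le_iff mem_Times_iff)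
    moreover have "csqrt (A t + of_real r * B t) * csqrt (cnj (A t) - of_real r * cnj (B t)) \<noteq> 0" if "\<bar>r\<bar> \<le> 1" for r t
      using csqrt_neq_0_Re_pos[OF ReAB[OF that]] csqrt_neq_0_Re_pos[OF ReAB'[OF that]] by simp
    ultimately show ?thesis
      unfolding split_def by (intro continuous_on_divide continuous_on_mult continuous_on_const) (simp_all add: abs_le_iff mem_Times_iff)
  qed
  have "torus_mean (m c) = cosine_mean (\<lambda>x. cosine_mean (\<lambda>r. 1 / sqrt (Q (r\<^sup>2) ((1 - x) / 2))))"
    unfolding torus_mean_def Qm
  proof (rule cosine_mean_cong)
    fix x :: real assume "\<bar>x\<bar> \<le> 1"
    then have "continuous_on {0..1} (\<lambda>X. 1 / sqrt (Q X ((1 - x) / 2)))"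
      by (intro continuous_on_compose2[OF contQ, of _ "\<lambda>X. (X, (1 - x) / 2)", simplified])
         (auto intro!: continuous_intros)
    then show "cosine_mean (\<lambda>y. 1 / sqrt (Q ((1 - y) / 2) ((1 - x) / 2))) = cosine_mean (\<lambda>r. 1 / sqrt (Q (r\<^sup>2) ((1 - x) / 2)))"
      by (rule cosine_mean_half_angle)
  qed
  also have "\<dots> = cosine_mean (\<lambda>s. cosine_mean (\<lambda>r. 1 / sqrt (Q (r\<^sup>2) (s\<^sup>2))))"
  proof (rule cosine_mean_half_angle)
    have "continuous_on ({0..1} \<times> {-1..1}) (\<lambda>(Y, r). 1 / sqrt (Q (r\<^sup>2) Y))"
      unfolding split_def
      by (rule continuous_on_compose2[OF contQ', of _ "\<lambda>p. (snd p, fst p)", simplified])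
         (auto intro!: continuous_intros)
    then show "continuous_on {0..1} (\<lambda>Y. cosine_mean (\<lambda>r. 1 / sqrt (Q (r\<^sup>2) Y)))"
      by (rule continuous_on_cosine_mean)
  qed
  also have "\<dots> = cosine_mean (\<lambda>r. cosine_mean (\<lambda>s. 1 / sqrt (Q (r\<^sup>2) (s\<^sup>2))))"
  proof (rule cosine_mean_swap)
    show "continuous_on ({-1..1} \<times> {-1..1}) (\<lambda>(s, r). 1 / sqrt (Q (r\<^sup>2) (s\<^sup>2)))"
      unfolding split_def
      by (rule continuous_on_compose2[OF contQ', of _ "\<lambda>p. (snd p, (fst p)\<^sup>2)", simplified])
         (auto intro!: continuous_intros simp: abs_square_le_1)
  qed
  finally have step1: "torus_mean (m c) = cosine_mean (\<lambda>r. cosine_mean (\<lambda>s. 1 / sqrt (Q (r\<^sup>2) (s\<^sup>2))))" .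
  \<comment> \<open>Landen transformation for fixed \<open>r\<close>\<close>
  have "cosine_mean (\<lambda>r. integral {- pi..pi} (\<lambda>t. 1 / (csqrt (A t + of_real r * B t) * csqrt (cnj (A t) - of_real r * cnj (B t)))))
      = cosine_mean (\<lambda>r. complex_of_real (2 * pi * cosine_mean (\<lambda>s. 1 / sqrt (Q (r\<^sup>2) (s\<^sup>2)))))"
  proof (rule cosine_mean_cong)
    fix r :: real assume r: "\<bar>r\<bar> \<le> 1"
    have "A t + of_real r * B t = of_real (a0 + r * a1) + of_real (a2 + r * a3) * cis t"
      "cnj (A t) - of_real r * cnj (B t) = of_real (a0 - r * a1) + of_real (a2 - r * a3) * cis (- t)" for t
      by (simp_all add: A_def B_def algebra_simps cis_cnj)
    moreover have "(a0 + r * a1) * (a0 - r * a1) - (a2 + r * a3) * (a2 - r * a3) * s\<^sup>2 = Q (r\<^sup>2) (s\<^sup>2)" for s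
      by (simp add: Q_def power2_eq_square algebra_simps)
    ultimately show "integral {- pi..pi} (\<lambda>t. 1 / (csqrt (A t + of_real r * B t) * csqrt (cnj (A t) - of_real r * cnj (B t))))
        = complex_of_real (2 * pi * cosine_mean (\<lambda>s. 1 / sqrt (Q (r\<^sup>2) (s\<^sup>2))))"
      using circle_integral_affine_factors[OF lin[OF r] lin[of "- r", simplified, OF r]] by simp
  qed
  also have "\<dots> = complex_of_real (2 * pi * torus_mean (m c))"
  proof (subst cosine_mean_of_real)
    have "continuous_on ({-1..1} \<times> {-1..1}) (\<lambda>(r, s). 1 / sqrt (Q (r\<^sup>2) (s\<^sup>2)))"
      unfolding split_def
      by (rule continuous_on_compose2[OF contQ', of _ "\<lambda>p. (fst p, (snd p)\<^sup>2)", simplified])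
         (auto intro!: continuous_intros simp: abs_square_le_1)
    then show "continuous_on {-1..1} (\<lambda>r. 2 * pi * cosine_mean (\<lambda>s. 1 / sqrt (Q (r\<^sup>2) (s\<^sup>2))))"
      by (intro continuous_intros continuous_on_cosine_mean)
  qed (simp only: step1 cosine_mean_mult_left)
  \<comment> \<open>exchange of the integrations, then the Moebius identity for fixed \<open>t\<close>\<close>
  finally have "complex_of_real (2 * pi * torus_mean (m c))
      = integral {- pi..pi} (\<lambda>t. cosine_mean (\<lambda>r. 1 / (csqrt (A t + of_real r * B t) * csqrt (cnj (A t) - of_real r * cnj (B t)))))"
    by (simp only: cosine_mean_integral_swap[OF contH])
  also have "\<dots> = integral {- pi..pi} (\<lambda>t. complex_of_real (cosine_mean (\<lambda>y. 1 / sqrt (quad_form c (cos t) y))))"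
    by (simp only: cosine_mean_conjugate_factors[OF ReA BA] quad)
  also have "\<dots> = (2 * pi) *\<^sub>R cosine_mean (\<lambda>x. complex_of_real (cosine_mean (\<lambda>y. 1 / sqrt (quad_form c x y))))"
    by (intro integral_of_cos_argument continuous_intros continuous_on_cosine_mean
          continuous_on_inverse_sqrt_quad_form c)
  also have "\<dots> = complex_of_real (2 * pi * torus_mean c)"
    unfolding torus_mean_def
    by (subst cosine_mean_of_real)
       (auto intro!: continuous_on_cosine_mean continuous_on_inverse_sqrt_quad_form c simp: scaleR_conv_of_real)
  finally have "2 * pi * torus_mean (m c) = 2 * pi * torus_mean c"
    by (simp only: of_real_eq_iff)
  then show ?thesis by simp
qed

section \<open>Convergence of the iteration\<close>

lemma torus_mean_bounds:
  assumes lo: "0 < lo" and c: "\<And>i. lo \<le> c$i" "\<And>i. c$i \<le> hi"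
  shows "1 / hi \<le> torus_mean c" "torus_mean c \<le> 1 / lo"
proof -
  have hi: "0 < hi" using lo c(1)[of 1] c(2)[of 1] by linarith
  have pos: "c$i > 0" for i using lo c(1)[of i] by linarith
  note cont2 = continuous_on_inverse_sqrt_quad_form[of c, OF pos]
  note cont = continuous_on_cosine_mean[OF cont2]
  have cont1: "continuous_on {-1..1} (\<lambda>y. 1 / sqrt (quad_form c x y))" if "\<bar>x\<bar> \<le> 1" for x
    by (rule continuous_on_compose2[OF cont2, of _ "\<lambda>y. (x, y)", simplified])
       (use that in \<open>auto intro!: continuous_intros\<close>)
  have bd: "1 / hi \<le> 1 / sqrt (quad_form c x y)" "1 / sqrt (quad_form c x y) \<le> 1 / lo"
    if "\<bar>x\<bar> \<le> 1" "\<bar>y\<bar> \<le> 1" for x y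
  proof -
    note b = quad_form_bounds[OF that less_imp_le[OF lo], of c hi, OF c]
    have "lo \<le> sqrt (quad_form c x y)" using lo b(1) by (simp add: real_le_rsqrt)
    moreover have "sqrt (quad_form c x y) \<le> hi" using hi b(2) by (simp add: real_le_lsqrt)
    ultimately show "1 / hi \<le> 1 / sqrt (quad_form c x y)" "1 / sqrt (quad_form c x y) \<le> 1 / lo"
      using lo hi by (auto intro!: divide_left_mono mult_pos_pos simp del: real_sqrt_gt_0_iff)
  qed
  have "cosine_mean (\<lambda>x. cosine_mean (\<lambda>y. 1 / hi)) \<le> torus_mean c"
    unfolding torus_mean_def
    by (intro cosine_mean_mono cont cont1 bd continuous_intros) auto
  then show "1 / hi \<le> torus_mean c" by simp
  have "torus_mean c \<le> cosine_mean (\<lambda>x. cosine_mean (\<lambda>y. 1 / lo))"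
    unfolding torus_mean_def
    by (intro cosine_mean_mono cont cont1 bd continuous_intros) auto
  then show "torus_mean c \<le> 1 / lo" by simp
qed

text \<open>
  The second and the third entry lie between the extremes without being compared, so that the notion is
  invariant under their exchange, with which \<open>m\<close> commutes.
\<close>

definition diamond_ordered :: "real^4 \<Rightarrow> bool" where
  "diamond_ordered u \<longleftrightarrow> u$1 \<ge> u$2 \<and> u$1 \<ge> u$3 \<and> u$2 \<ge> u$4 \<and> u$3 \<ge> u$4 \<and> u$4 > 0"

lemma diamond_ordered_bounds:
  assumes "diamond_ordered u"
  shows "u$4 \<le> u$i" "u$i \<le> u$1" "0 < u$i"
  using assms exhaust_4[of i] by (auto simp: diamond_ordered_def)

text \<open>
  After one step the largest component is the arithmetic mean, which already contains a quarter of
  the smallest one, while the smallest component does not decrease; hence the spread shrinks by the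
  factor \<open>3/4\<close>.
\<close>

lemma diamond_ordered_m:
  assumes u: "diamond_ordered u"
  shows "diamond_ordered (m u)" "m u $ 1 \<le> u$1" "u$4 \<le> m u $ 4"
    "m u $ 1 - m u $ 4 \<le> 3/4 * (u$1 - u$4)"
proof -
  have pos: "0 < u$i" for i using diamond_ordered_bounds(3)[OF u] .
  have ord: "u$1 \<ge> u$2" "u$1 \<ge> u$3" "u$2 \<ge> u$4" "u$3 \<ge> u$4" using u by (auto simp: diamond_ordered_def)
  have "m u $ 2 \<le> m u $ 1"
    using arith_geo_mean_sqrt[of "u$1 + u$3" "u$2 + u$4"] pos[of 1] pos[of 2] pos[of 3] pos[of 4] by simp
  moreover have "m u $ 3 \<le> m u $ 1"
    using arith_geo_mean_sqrt[of "u$1 + u$2" "u$3 + u$4"] pos[of 1] pos[of 2] pos[of 3] pos[of 4] by simp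
  moreover have "m u $ 4 \<le> m u $ 2"
  proof -
    have "0 \<le> (u$1 - u$3) * (u$2 - u$4)" using ord by simp
    then have "m u $ 4 \<le> sqrt ((u$1 + u$3) * (u$2 + u$4) / 4)"
      unfolding m_component by (intro real_sqrt_le_mono) (simp add: algebra_simps)
    then show ?thesis by (simp add: real_sqrt_divide)
  qed
  moreover have "m u $ 4 \<le> m u $ 3"
  proof -
    have "0 \<le> (u$1 - u$2) * (u$3 - u$4)" using ord by simp
    then have "m u $ 4 \<le> sqrt ((u$1 + u$2) * (u$3 + u$4) / 4)"
      unfolding m_component by (intro real_sqrt_le_mono) (simp add: algebra_simps)
    then show ?thesis by (simp add: real_sqrt_divide)
  qed
  ultimately show "diamond_ordered (m u)"
    using m_pos[OF pos, of 4] by (simp add: diamond_ordered_def del: m_component)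
  show m4: "u$4 \<le> m u $ 4"
  proof -
    have "u$4 * u$4 \<le> u$1 * u$4" "u$4 * u$4 \<le> u$2 * u$3"
      using ord pos[of 4] by (auto intro!: mult_mono)
    then have "(u$4)\<^sup>2 \<le> (u$1 * u$4 + u$2 * u$3) / 2" by (simp add: power2_eq_square)
    then show ?thesis unfolding m_component using pos[of 4] by (intro real_le_rsqrt)
  qed
  show "m u $ 1 \<le> u$1" using ord by simp
  show "m u $ 1 - m u $ 4 \<le> 3/4 * (u$1 - u$4)"
  proof -
    have "(a + b + c + d) / 4 - e \<le> 3/4 * (a - d)" if "b \<le> a" "c \<le> a" "d \<le> e" for a b c d e :: real
      using that by (simp add: field_simps)
    from this[OF ord(1,2) m4] show ?thesis unfolding m_component(1) .
  qed
qed

text \<open>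
  The torus mean is constant along the iteration and lies between the reciprocals of the largest and of
  the smallest component, both of which tend to \<open>1 / l\<close>.
\<close>

theorem iterates_of_m_converge:
  assumes c: "diamond_ordered c"
  obtains l where "l > 0" "torus_mean c = 1 / l" "\<And>i. (\<lambda>n. ((m ^^ n) c) $ i) \<longlonglongrightarrow> l"
proof -
  define u where "u = (\<lambda>n. (m ^^ n) c)"
  have uS: "u (Suc n) = m (u n)" for n by (simp add: u_def)
  have D: "diamond_ordered (u n)" for n
    by (induction n) (simp_all add: uS diamond_ordered_m(1) c u_def)
  have gap: "u n $ 1 - u n $ 4 \<le> (3/4) ^ n * (c$1 - c$4)" for n
  proof (induction n)
    case (Suc n)
    have "u (Suc n) $ 1 - u (Suc n) $ 4 \<le> 3/4 * (u n $ 1 - u n $ 4)"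
      unfolding uS by (rule diamond_ordered_m(4)[OF D])
    also have "\<dots> \<le> 3/4 * ((3/4) ^ n * (c$1 - c$4))" using Suc by simp
    finally show ?case by simp
  qed (simp add: u_def)
  have "(\<lambda>n. u n $ 1 - u n $ 4) \<longlonglongrightarrow> 0"
  proof (rule tendsto_sandwich)
    show "\<forall>\<^sub>F n in sequentially. 0 \<le> u n $ 1 - u n $ 4"
      using diamond_ordered_bounds(1)[OF D, of _ 1] by simp
    show "\<forall>\<^sub>F n in sequentially. u n $ 1 - u n $ 4 \<le> (3/4) ^ n * (c$1 - c$4)" using gap by simp
    show "(\<lambda>n. (3/4) ^ n * (c$1 - c$4)) \<longlonglongrightarrow> 0"
      using tendsto_mult_left_zero[OF LIMSEQ_realpow_zero[of "3/4"]] by simp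
  qed simp
  then have "(\<lambda>n. u n $ 4 - u n $ 1) \<longlonglongrightarrow> 0" using tendsto_minus by fastforce
  then obtain l where l: "\<And>n. u n $ 4 \<le> l" "(\<lambda>n. u n $ 4) \<longlonglongrightarrow> l" "(\<lambda>n. u n $ 1) \<longlonglongrightarrow> l"
    using nested_sequence_unique[of "\<lambda>n. u n $ 4" "\<lambda>n. u n $ 1"]
      diamond_ordered_m(2,3)[OF D] diamond_ordered_bounds(1)[OF D, of _ 1] by (auto simp: uS simp del: m_component)
  have l0: "l > 0" using l(1)[of 0] diamond_ordered_bounds(3)[OF D, of 0 4] by linarith
  have lim: "(\<lambda>n. u n $ i) \<longlonglongrightarrow> l" for i
    by (rule tendsto_sandwich[OF _ _ l(2,3)]) (use diamond_ordered_bounds[OF D] in auto)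
  have inv: "torus_mean (u n) = torus_mean c" for n
  proof (induction n)
    case (Suc n)
    then show ?case unfolding uS using torus_mean_m[of "u n"] diamond_ordered_bounds(3)[OF D] by simp
  qed (simp add: u_def)
  have bd: "1 / u n $ 1 \<le> torus_mean c" "torus_mean c \<le> 1 / u n $ 4" for n
    using torus_mean_bounds[of "u n $ 4" "u n" "u n $ 1"] diamond_ordered_bounds[OF D] unfolding inv by auto
  have lim14: "(\<lambda>n. 1 / u n $ 1) \<longlonglongrightarrow> 1 / l" "(\<lambda>n. 1 / u n $ 4) \<longlonglongrightarrow> 1 / l"
    using l0 l by (auto intro!: tendsto_intros)
  have "torus_mean c = 1 / l"
    by (rule antisym[OF LIMSEQ_le_const[OF lim14(2)] LIMSEQ_le_const2[OF lim14(1)]]) (use bd in auto)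
  then show ?thesis using l0 lim that by (simp add: u_def)
qed

corollary m_common_limit_eq_torus_mean:
  assumes "diamond_ordered c"
  shows "(\<lambda>n. ((m ^^ n) c) $ i) \<longlonglongrightarrow> m_common_limit c" "torus_mean c > 0"
    "m_common_limit c = 1 / torus_mean c"
proof -
  obtain l where l: "l > 0" "torus_mean c = 1 / l" "\<And>i. (\<lambda>n. ((m ^^ n) c) $ i) \<longlonglongrightarrow> l"
    using iterates_of_m_converge[OF assms] by blast
  have "m_common_limit c = l"
    unfolding m_common_limit_def by (rule the_equality) (use l(3) LIMSEQ_unique in blast)+
  then show "(\<lambda>n. ((m ^^ n) c) $ i) \<longlonglongrightarrow> m_common_limit c" "torus_mean c > 0"
    "m_common_limit c = 1 / torus_mean c" using l by simp_all
qed

text \<open>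
  Exchanging the second and third entry exchanges the two angles.  This is why the limit has two
  expressions by the hypergeometric function.
\<close>

lemma torus_mean_swap:
  assumes "\<And>i. c$i > 0" "d$1 = c$1" "d$2 = c$3" "d$3 = c$2" "d$4 = c$4"
  shows "torus_mean d = torus_mean c"
proof -
  have "quad_form d x y = quad_form c y x" for x y
    by (simp add: quad_form_def assms(2-) algebra_simps)
  then show ?thesis
    unfolding torus_mean_def
    by (simp add: cosine_mean_swap[OF continuous_on_inverse_sqrt_quad_form[of c, OF assms(1)]])
qed

section \<open>The Euler integral as a mean\<close>

text \<open>
  The Euler integral after the substitutions \<open>s\<^sub>1 = (1 - x) / 2\<close> and \<open>s\<^sub>2 = (1 - y) / 2\<close>, under which
  \<open>ds / (\<pi> sqrt (s (1 - s)))\<close> becomes the arcsine law.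
\<close>

definition euler_mean :: "real \<Rightarrow> real \<Rightarrow> real \<Rightarrow> real \<Rightarrow> real" where
  "euler_mean z1 z2 z3 z4 = cosine_mean (\<lambda>x. cosine_mean (\<lambda>y.
     1 / (sqrt (1 - z1 * ((1 - x) / 2) - z2 * ((1 - y) / 2)) * sqrt (1 - z3 * ((1 - x) / 2) - z4 * ((1 - y) / 2)))))"

lemma continuous_on_half_angles:
  fixes \<Phi> :: "real \<Rightarrow> real \<Rightarrow> 'a::topological_space"
  assumes "continuous_on ({0..1} \<times> {0..1}) (\<lambda>(s, t). \<Phi> s t)"
  shows "continuous_on ({-1..1} \<times> {-1..1}) (\<lambda>(x, y). \<Phi> ((1 - x) / 2) ((1 - y) / 2))"
  unfolding split_def
  by (rule continuous_on_compose2[OF assms, of _ "\<lambda>p. ((1 - fst p) / 2, (1 - snd p) / 2)", simplified])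
     (auto intro!: continuous_intros)

text \<open>
  The substitution \<open>s = (1 - cos t) / 2\<close>.  It is stated for the integral of nonnegative functions because
  Tonelli's theorem then gives the two-dimensional version although the integrand is unbounded.
\<close>

lemma nn_integral_arcsine:
  fixes \<phi> :: "real \<Rightarrow> real"
  assumes cont: "continuous_on {0..1} \<phi>" and nonneg: "\<And>s. s \<in> {0..1} \<Longrightarrow> 0 \<le> \<phi> s"
  shows "(\<integral>\<^sup>+s. ennreal (indicator {0<..<1} s * (\<phi> s / sqrt (s * (1 - s)))) \<partial>lborel)
       = ennreal (pi * cosine_mean (\<lambda>x. \<phi> ((1 - x) / 2)))"
proof -
  define f where "f = (\<lambda>s. \<phi> s / sqrt (s * (1 - s)))"
  define g where "g = (\<lambda>t::real. (1 - cos t) / 2)"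
  have g01: "g 0 = 0" "g pi = 1" by (simp_all add: g_def)
  have AE: "AE s in lborel. s \<noteq> (0::real) \<and> s \<noteq> 1" "AE t in lborel. t \<noteq> (0::real) \<and> t \<noteq> pi"
    by (auto intro!: AE_conjI AE_lborel_singleton)
  have "(\<integral>\<^sup>+s. ennreal (indicator {0<..<1} s * f s) \<partial>lborel) = (\<integral>\<^sup>+s. f s * indicator {g 0..g pi} s \<partial>lborel)"
    by (intro nn_integral_cong_AE) (use AE(1) in \<open>eventually_elim, auto simp: g01 indicator_def\<close>)
  also have "\<dots> = (\<integral>\<^sup>+t. f (g t) * (sin t / 2) * indicator {0..pi} t \<partial>lborel)"
  proof (rule nn_integral_substitution)
    have "(\<lambda>s. indicator {0..1} s *\<^sub>R \<phi> s) \<in> borel_measurable borel"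
      by (rule borel_measurable_continuous_on_indicator[OF _ cont]) simp
    then have "(\<lambda>s. (indicator {0..1} s *\<^sub>R \<phi> s) / sqrt (s * (1 - s))) \<in> borel_measurable borel"
      by (rule borel_measurable_divide) simp
    then show "set_borel_measurable borel {g 0..g pi} f"
      by (simp add: set_borel_measurable_def g01 f_def)
    show "(g has_real_derivative sin t / 2) (at t)" for t
      unfolding g_def by (auto intro!: derivative_eq_intros)
  qed (auto intro!: continuous_intros sin_ge_zero)
  also have "\<dots> = (\<integral>\<^sup>+t. ennreal (\<phi> (g t)) * indicator {0..pi} t \<partial>lborel)"
  proof (intro nn_integral_cong_AE, use AE(2) in eventually_elim)
    fix t :: real assume t: "t \<noteq> 0 \<and> t \<noteq> pi"
    show "ennreal (f (g t) * (sin t / 2) * indicator {0..pi} t) = ennreal (\<phi> (g t)) * indicator {0..pi} t"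
    proof (cases "t \<in> {0..pi}")
      case True
      then have s: "sin t > 0" using t by (intro sin_gt_zero) auto
      have "g t * (1 - g t) = (1 - (cos t)\<^sup>2) / 4"
        by (simp add: g_def power2_eq_square field_simps)
      also have "\<dots> = (sin t / 2)\<^sup>2" by (simp add: power_divide sin_squared_eq)
      finally have "g t * (1 - g t) = (sin t / 2)\<^sup>2" .
      then have "sqrt (g t * (1 - g t)) = sin t / 2" using s by (simp add: real_sqrt_unique)
      then show ?thesis using s True by (simp add: f_def)
    qed simp
  qed
  also have "\<dots> = ennreal (integral {0..pi} (\<lambda>t. \<phi> (g t)))"
  proof (rule nn_integral_has_integral_lebesgue')
    have "continuous_on {0..pi} (\<lambda>t. \<phi> (g t))"
      unfolding g_def by (rule continuous_on_compose2[OF cont]) (auto intro!: continuous_intros)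
    then show "((\<lambda>t. \<phi> (g t)) has_integral integral {0..pi} (\<lambda>t. \<phi> (g t))) {0..pi}"
      by (intro integrable_integral integrable_continuous_interval)
    show "0 \<le> \<phi> (g t)" for t by (rule nonneg) (simp add: g_def)
  qed
  finally show ?thesis by (simp add: f_def g_def cosine_mean_def)
qed

lemma nn_integral_arcsine_square:
  fixes \<Phi> :: "real \<Rightarrow> real \<Rightarrow> real"
  assumes cont: "continuous_on ({0..1} \<times> {0..1}) (\<lambda>(s, t). \<Phi> s t)"
    and nonneg: "\<And>s t. s \<in> {0..1} \<Longrightarrow> t \<in> {0..1} \<Longrightarrow> 0 \<le> \<Phi> s t"
    and meas: "(\<lambda>p. \<Phi> (fst p) (snd p)) \<in> borel_measurable borel"
  shows "(\<integral>\<^sup>+p. ennreal (indicator ({0<..<1} \<times> {0<..<1}) p *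
            (\<Phi> (fst p) (snd p) / (sqrt (fst p * (1 - fst p)) * sqrt (snd p * (1 - snd p))))) \<partial>lborel)
       = ennreal (pi\<^sup>2 * cosine_mean (\<lambda>x. cosine_mean (\<lambda>y. \<Phi> ((1 - x) / 2) ((1 - y) / 2))))"
proof -
  define h where "h = (\<lambda>p. ennreal (indicator ({0<..<1} \<times> {0<..<1}) p *
            (\<Phi> (fst p) (snd p) / (sqrt (fst p * (1 - fst p)) * sqrt (snd p * (1 - snd p))))))"
  define k where "k = (\<lambda>s. cosine_mean (\<lambda>y. \<Phi> s ((1 - y) / 2)))"
  have "h \<in> borel_measurable borel"
    unfolding h_def
    by (intro measurable_compose[OF _ measurable_ennreal] borel_measurable_times borel_measurable_divide meas
          borel_measurable_indicator borel_measurable_continuous_onI continuous_intros)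
       (auto intro!: borel_open open_Times)
  then have hm: "h \<in> borel_measurable (lborel \<Otimes>\<^sub>M lborel)" by (simp add: lborel_prod)
  have contk: "continuous_on {0..1} k"
  proof -
    have "continuous_on ({0..1} \<times> {-1..1}) (\<lambda>(s, y). \<Phi> s ((1 - y) / 2))"
      unfolding split_def
      by (rule continuous_on_compose2[OF cont, of _ "\<lambda>p. (fst p, (1 - snd p) / 2)", simplified])
         (auto intro!: continuous_intros)
    then show ?thesis unfolding k_def by (rule continuous_on_cosine_mean)
  qed
  have cont1: "continuous_on {0..1} (\<Phi> s)" if "s \<in> {0..1}" for s
    by (rule continuous_on_compose2[OF cont, of _ "\<lambda>t. (s, t)", simplified])
       (use that in \<open>auto intro!: continuous_intros\<close>)
  have knn: "0 \<le> k s" if s: "s \<in> {0..1}" for s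
  proof -
    have "cosine_mean (\<lambda>y. 0) \<le> k s"
      unfolding k_def
    proof (rule cosine_mean_mono)
      show "continuous_on {-1..1} (\<lambda>y. \<Phi> s ((1 - y) / 2))"
        by (rule continuous_on_compose2[OF cont1[OF s]]) (auto intro!: continuous_intros)
    qed (use s in \<open>auto intro!: nonneg simp: abs_le_iff\<close>)
    then show ?thesis by simp
  qed
  have inner: "(\<integral>\<^sup>+t. h (s, t) \<partial>lborel) = ennreal (pi) * ennreal (indicator {0<..<1} s * (k s / sqrt (s * (1 - s))))" for s
  proof (cases "s \<in> {0<..<1}")
    case True
    have "(\<integral>\<^sup>+t. h (s, t) \<partial>lborel) = (\<integral>\<^sup>+t. ennreal (1 / sqrt (s * (1 - s))) * ennreal (indicator {0<..<1} t * (\<Phi> s t / sqrt (t * (1 - t)))) \<partial>lborel)"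
      using True by (intro nn_integral_cong) (auto simp: h_def indicator_def ennreal_mult'[symmetric])
    also have "\<dots> = ennreal (1 / sqrt (s * (1 - s))) * (\<integral>\<^sup>+t. ennreal (indicator {0<..<1} t * (\<Phi> s t / sqrt (t * (1 - t)))) \<partial>lborel)"
    proof (rule nn_integral_cmult)
      have "(\<lambda>t. \<Phi> (fst (s, t)) (snd (s, t))) \<in> borel_measurable borel"
        by (rule measurable_compose[OF _ meas]) (intro borel_measurable_continuous_onI continuous_intros)
      then show "(\<lambda>t. ennreal (indicator {0<..<1} t * (\<Phi> s t / sqrt (t * (1 - t))))) \<in> borel_measurable lborel"
        by simp
    qed
    also have "\<dots> = ennreal (1 / sqrt (s * (1 - s))) * ennreal (pi * k s)"
      using True by (subst nn_integral_arcsine) (auto intro!: cont1 nonneg simp: k_def)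
    also have "\<dots> = ennreal pi * ennreal (indicator {0<..<1} s * (k s / sqrt (s * (1 - s))))"
      using True knn[of s] by (simp add: ennreal_mult'[symmetric])
    finally show ?thesis .
  qed (auto simp: h_def)
  have "(\<integral>\<^sup>+p. h p \<partial>lborel) = (\<integral>\<^sup>+s. \<integral>\<^sup>+t. h (s, t) \<partial>lborel \<partial>lborel)"
    using lborel.nn_integral_fst[OF hm] by (simp add: lborel_prod)
  also have "\<dots> = (\<integral>\<^sup>+s. ennreal pi * ennreal (indicator {0<..<1} s * (k s / sqrt (s * (1 - s)))) \<partial>lborel)"
    by (simp only: inner)
  also have "\<dots> = ennreal pi * (\<integral>\<^sup>+s. ennreal (indicator {0<..<1} s * (k s / sqrt (s * (1 - s)))) \<partial>lborel)"
  proof (rule nn_integral_cmult)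
    have "(\<lambda>s. indicator {0<..<1} s *\<^sub>R k s) \<in> borel_measurable borel"
      by (rule borel_measurable_continuous_on_indicator[OF _ continuous_on_subset[OF contk]]) auto
    then have "(\<lambda>s. (indicator {0<..<1} s *\<^sub>R k s) / sqrt (s * (1 - s))) \<in> borel_measurable borel"
      by (rule borel_measurable_divide) simp
    then show "(\<lambda>s. ennreal (indicator {0<..<1} s * (k s / sqrt (s * (1 - s))))) \<in> borel_measurable lborel"
      by simp
  qed
  also have "\<dots> = ennreal pi * ennreal (pi * cosine_mean (\<lambda>x. k ((1 - x) / 2)))"
    by (subst nn_integral_arcsine[OF contk knn]) auto
  also have "\<dots> = ennreal (pi\<^sup>2 * cosine_mean (\<lambda>x. k ((1 - x) / 2)))"
    by (simp add: ennreal_mult'[symmetric] power2_eq_square mult.assoc)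
  finally show ?thesis by (simp only: h_def k_def)
qed

lemma continuous_on_euler_integrand:
  assumes "\<And>s t. s \<in> {0..1} \<Longrightarrow> t \<in> {0..1} \<Longrightarrow> 1 - z1 * s - z2 * t > 0 \<and> 1 - z3 * s - z4 * t > (0::real)"
  shows "continuous_on ({0..1} \<times> {0..1}) (\<lambda>(s, t). 1 / (sqrt (1 - z1 * s - z2 * t) * sqrt (1 - z3 * s - z4 * t)))"
  unfolding split_def
proof (intro continuous_intros ballI)
  fix p :: "real \<times> real" assume "p \<in> {0..1} \<times> {0..1}"
  then show "sqrt (1 - z1 * fst p - z2 * snd p) * sqrt (1 - z3 * fst p - z4 * snd p) \<noteq> 0"
    using assms[of "fst p" "snd p"] by auto
qed

lemma F_S_integral_eq_euler_mean:
  fixes z :: "complex^2^2"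
  assumes z: "z$1$1 = of_real z1" "z$2$1 = of_real z2" "z$1$2 = of_real z3" "z$2$2 = of_real z4"
    and pos: "\<And>s t. s \<in> {0..1} \<Longrightarrow> t \<in> {0..1} \<Longrightarrow> 1 - z1 * s - z2 * t > 0 \<and> 1 - z3 * s - z4 * t > 0"
  shows "F_S_integral z = of_real (euler_mean z1 z2 z3 z4)"
proof -
  define \<Phi> where "\<Phi> = (\<lambda>s t. 1 / (sqrt (1 - z1 * s - z2 * t) * sqrt (1 - z3 * s - z4 * t)))"
  define \<psi> where "\<psi> = (\<lambda>p. indicator ({0<..<1} \<times> {0<..<1}) p *
            (\<Phi> (fst p) (snd p) / (sqrt (fst p * (1 - fst p)) * sqrt (snd p * (1 - snd p)))))"
  have meas: "(\<lambda>p. \<Phi> (fst p) (snd p)) \<in> borel_measurable borel"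
    unfolding \<Phi>_def by (intro borel_measurable_divide borel_measurable_continuous_onI continuous_intros)
  have cont: "continuous_on ({0..1} \<times> {0..1}) (\<lambda>(s, t). \<Phi> s t)"
    unfolding \<Phi>_def by (rule continuous_on_euler_integrand[OF pos])
  have nn: "0 \<le> \<Phi> s t" if "s \<in> {0..1}" "t \<in> {0..1}" for s t
    using pos[OF that] by (simp add: \<Phi>_def less_imp_le)
  have \<psi>m: "\<psi> \<in> borel_measurable borel"
    unfolding \<psi>_def
    by (intro borel_measurable_times borel_measurable_divide meas
          borel_measurable_indicator borel_measurable_continuous_onI continuous_intros)
       (auto intro!: borel_open open_Times)
  have \<psi>nn: "0 \<le> \<psi> p" for p
    using nn[of "fst p" "snd p"] by (auto simp: \<psi>_def indicator_def)
  have "(LINT s : {0<..<1} \<times> {0<..<1} | lborel.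
        (case s of (s1, s2) \<Rightarrow>
           1 / (complex_of_real (sqrt (s1 * (1 - s1) * s2 * (1 - s2))) *
                csqrt (1 - z$1$1 * complex_of_real s1 - z$2$1 * complex_of_real s2) *
                csqrt (1 - z$1$2 * complex_of_real s1 - z$2$2 * complex_of_real s2))))
      = (LINT p | lborel. complex_of_real (\<psi> p))"
    unfolding set_lebesgue_integral_def
  proof (rule Bochner_Integration.integral_cong)
    fix p :: "real \<times> real"
    obtain s t where p: "p = (s, t)" by (cases p)
    show "indicat_real ({0<..<1} \<times> {0<..<1}) p *\<^sub>R (case p of (s1, s2) \<Rightarrow>
           1 / (complex_of_real (sqrt (s1 * (1 - s1) * s2 * (1 - s2))) *
                csqrt (1 - z$1$1 * complex_of_real s1 - z$2$1 * complex_of_real s2) *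
                csqrt (1 - z$1$2 * complex_of_real s1 - z$2$2 * complex_of_real s2))) = complex_of_real (\<psi> p)"
    proof (cases "p \<in> {0<..<1} \<times> {0<..<1}")
      case True
      then have "s \<in> {0..1}" "t \<in> {0..1}" by (auto simp: p)
      note q = pos[OF this]
      have "csqrt (1 - of_real z1 * complex_of_real s - of_real z2 * complex_of_real t) = of_real (sqrt (1 - z1 * s - z2 * t))"
        "csqrt (1 - of_real z3 * complex_of_real s - of_real z4 * complex_of_real t) = of_real (sqrt (1 - z3 * s - z4 * t))"
        using q of_real_sqrt[of "1 - z1 * s - z2 * t"] of_real_sqrt[of "1 - z3 * s - z4 * t"] by simp_all
      then show ?thesis
        using True by (simp add: p z \<psi>_def \<Phi>_def real_sqrt_mult mult_ac)
    qed (simp add: \<psi>_def)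
  qed simp
  also have "\<dots> = of_real (enn2real (\<integral>\<^sup>+p. ennreal (\<psi> p) \<partial>lborel))"
    using \<psi>m \<psi>nn by (simp add: integral_eq_nn_integral)
  also have "(\<integral>\<^sup>+p. ennreal (\<psi> p) \<partial>lborel) = ennreal (pi\<^sup>2 * euler_mean z1 z2 z3 z4)"
    using nn_integral_arcsine_square[OF cont nn meas] by (simp only: \<psi>_def \<Phi>_def euler_mean_def)
  also have "enn2real \<dots> = pi\<^sup>2 * euler_mean z1 z2 z3 z4"
  proof -
    have c2: "continuous_on ({-1..1} \<times> {-1..1}) (\<lambda>(x, y). \<Phi> ((1 - x) / 2) ((1 - y) / 2))"
      by (rule continuous_on_half_angles[OF cont])
    have "cosine_mean (\<lambda>x. cosine_mean (\<lambda>y. 0)) \<le> cosine_mean (\<lambda>x. cosine_mean (\<lambda>y. \<Phi> ((1 - x) / 2) ((1 - y) / 2)))"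
    proof (intro cosine_mean_mono continuous_on_cosine_mean[OF c2] continuous_intros)
      fix x :: real assume "\<bar>x\<bar> \<le> 1"
      then show "continuous_on {-1..1} (\<lambda>y. \<Phi> ((1 - x) / 2) ((1 - y) / 2))"
        by (intro continuous_on_compose2[OF c2, of _ "\<lambda>y. (x, y)", simplified]) (auto intro!: continuous_intros)
    qed (auto intro!: nn simp: abs_le_iff)
    then have "0 \<le> euler_mean z1 z2 z3 z4" by (simp add: euler_mean_def \<Phi>_def)
    then show ?thesis by simp
  qed
  finally show ?thesis unfolding F_S_integral_def by simp
qed

section \<open>The hypergeometric series\<close>

lemma has_sum_inv_sqrt_real:
  fixes r :: real
  assumes "\<bar>r\<bar> < 1"
  shows "((\<lambda>n. inv_sqrt_coeff n * r ^ n) has_sum 1 / sqrt (1 - r)) UNIV"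
proof -
  have "csqrt (1 - of_real r) = of_real (sqrt (1 - r))"
    using of_real_sqrt[of "1 - r"] assms by simp
  then have "((\<lambda>n. complex_of_real (inv_sqrt_coeff n * r ^ n)) has_sum of_real (1 / sqrt (1 - r))) UNIV"
    using has_sum_inv_csqrt[of "of_real r"] assms by simp
  then show ?thesis by (simp only: has_sum_of_real_iff)
qed

text \<open>
  The coefficients of \<open>1 / sqrt (1 - x - y)\<close> as a double power series.
\<close>

definition inv_sqrt_coeff2 :: "nat \<Rightarrow> nat \<Rightarrow> real" where
  "inv_sqrt_coeff2 a b = pochhammer (1/2) (a + b) / (fact a * fact b)"

text \<open>
  Grouping the terms by total degree \<open>N\<close> turns the double series into the binomial expansions of
  \<open>(x + y) ^ N\<close>.  Applied to absolute values this gives the summability that justifies the grouping.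
\<close>

lemma has_sum_inv_sqrt_two_variables:
  fixes x y :: real
  assumes xy: "\<bar>x\<bar> + \<bar>y\<bar> < 1"
  shows "((\<lambda>(a, b). inv_sqrt_coeff2 a b * x ^ a * y ^ b) has_sum 1 / sqrt (1 - x - y)) UNIV"
    and "(\<lambda>(a, b). inv_sqrt_coeff2 a b * \<bar>x\<bar> ^ a * \<bar>y\<bar> ^ b) summable_on UNIV"
proof -
  define T where "T = (\<lambda>x y (N, a). inv_sqrt_coeff N * (real (N choose a) * x ^ a * y ^ (N - a)))"
  define I where "I = (SIGMA N:(UNIV :: nat set). {..N})"
  have reindex: "((\<lambda>(a, b). inv_sqrt_coeff2 a b * x ^ a * y ^ b) has_sum S) UNIV \<longleftrightarrow> (T x y has_sum S) I" for x y S
  proof (rule has_sum_reindex_bij_witness[where i = "\<lambda>(N, a). (a, N - a)" and j = "\<lambda>(a, b). (a + b, a)"])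
    show "T x y (case p of (a, b) \<Rightarrow> (a + b, a)) = (case p of (a, b) \<Rightarrow> inv_sqrt_coeff2 a b * x ^ a * y ^ b)" for p
      by (cases p) (simp add: T_def inv_sqrt_coeff_def inv_sqrt_coeff2_def binomial_fact)
  qed (auto simp: I_def)
  have row: "((\<lambda>a. T x y (N, a)) has_sum inv_sqrt_coeff N * (x + y) ^ N) {..N}" for x y N
    using has_sum_finite[of "{..N}" "\<lambda>a. T x y (N, a)"]
    by (simp add: T_def binomial_ring sum_distrib_left)
  have xy': "\<bar>\<bar>x\<bar> + \<bar>y\<bar>\<bar> < 1" "\<bar>x + y\<bar> < 1" using xy by auto
  have abs: "T \<bar>x\<bar> \<bar>y\<bar> summable_on I"
    unfolding I_def
  proof (rule summable_on_SigmaI[OF row])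
    show "(\<lambda>N. inv_sqrt_coeff N * (\<bar>x\<bar> + \<bar>y\<bar>) ^ N) summable_on UNIV"
      using has_sum_inv_sqrt_real[OF xy'(1)] by (rule has_sum_imp_summable)
  qed (simp add: T_def)
  then show "(\<lambda>(a, b). inv_sqrt_coeff2 a b * \<bar>x\<bar> ^ a * \<bar>y\<bar> ^ b) summable_on UNIV"
    using reindex[of "\<bar>x\<bar>" "\<bar>y\<bar>"] unfolding summable_on_def by blast
  have "(\<lambda>p. norm (T x y p)) = T \<bar>x\<bar> \<bar>y\<bar>"
    by (auto simp: T_def fun_eq_iff abs_mult power_abs)
  then have "T x y summable_on I" using abs abs_summable_summable[of "T x y" I] by simp
  then have "(T x y has_sum 1 / sqrt (1 - (x + y))) I"
    unfolding I_def by (intro has_sum_SigmaI[OF row has_sum_inv_sqrt_real[OF xy'(2)]])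
  then show "((\<lambda>(a, b). inv_sqrt_coeff2 a b * x ^ a * y ^ b) has_sum 1 / sqrt (1 - x - y)) UNIV"
    unfolding reindex by (simp add: diff_diff_eq)
qed

lemma has_sum_cosine_means:
  fixes f :: "'i \<Rightarrow> real \<Rightarrow> real \<Rightarrow> real"
  assumes bound: "\<And>n x y. n \<in> I \<Longrightarrow> \<bar>x\<bar> \<le> 1 \<Longrightarrow> \<bar>y\<bar> \<le> 1 \<Longrightarrow> \<bar>f n x y\<bar> \<le> M n" and M: "M summable_on I"
    and cont: "\<And>n. continuous_on ({-1..1} \<times> {-1..1}) (\<lambda>(x, y). f n x y)"
    and contS: "continuous_on ({-1..1} \<times> {-1..1}) (\<lambda>(x, y). S x y)"
    and sum: "\<And>x y. \<bar>x\<bar> \<le> 1 \<Longrightarrow> \<bar>y\<bar> \<le> 1 \<Longrightarrow> ((\<lambda>n. f n x y) has_sum S x y) I"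
  shows "((\<lambda>n. cosine_mean (\<lambda>x. cosine_mean (\<lambda>y. f n x y))) has_sum cosine_mean (\<lambda>x. cosine_mean (\<lambda>y. S x y))) I"
proof -
  have sq: "continuous_on (cbox (0,0) (pi,pi)) (\<lambda>p. g (cos (fst p)) (cos (snd p)))"
    "integral (cbox (0,0) (pi,pi)) (\<lambda>p. g (cos (fst p)) (cos (snd p))) = pi\<^sup>2 * cosine_mean (\<lambda>x. cosine_mean (\<lambda>y. g x y))"
    if g: "continuous_on ({-1..1} \<times> {-1..1}) (\<lambda>(x, y). g x y)" for g :: "real \<Rightarrow> real \<Rightarrow> real"
  proof -
    show c: "continuous_on (cbox (0,0) (pi,pi)) (\<lambda>p. g (cos (fst p)) (cos (snd p)))"
      by (rule continuous_on_compose2[OF g, of _ "\<lambda>p. (cos (fst p), cos (snd p))", simplified])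
         (auto intro!: continuous_intros)
    show "integral (cbox (0,0) (pi,pi)) (\<lambda>p. g (cos (fst p)) (cos (snd p))) = pi\<^sup>2 * cosine_mean (\<lambda>x. cosine_mean (\<lambda>y. g x y))"
      using integral_prod_continuous[OF c] by (simp add: cosine_mean_def power2_eq_square)
  qed
  have "((\<lambda>n. integral (cbox (0,0) (pi,pi)) (\<lambda>p. f n (cos (fst p)) (cos (snd p)))) has_sum
      integral (cbox (0,0) (pi,pi)) (\<lambda>p. S (cos (fst p)) (cos (snd p)))) I"
    by (rule has_sum_integral_cbox[OF _ M]) (auto intro: bound sum sq(1)[OF cont])
  then have "((\<lambda>n. pi\<^sup>2 * cosine_mean (\<lambda>x. cosine_mean (\<lambda>y. f n x y))) has_sum
      pi\<^sup>2 * cosine_mean (\<lambda>x. cosine_mean (\<lambda>y. S x y))) I"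
    by (simp only: sq(2)[OF cont] sq(2)[OF contS])
  then show ?thesis by (subst (asm) has_sum_cmult_right_iff) auto
qed

lemma linear_factor_pos:
  fixes a b :: real
  assumes "\<bar>a\<bar> + \<bar>b\<bar> < 1" "s \<in> {0..1}" "t \<in> {0..1}"
  shows "\<bar>a * s\<bar> + \<bar>b * t\<bar> < 1" "1 - a * s - b * t > 0"
proof -
  have "\<bar>a * s\<bar> \<le> \<bar>a\<bar>" "\<bar>b * t\<bar> \<le> \<bar>b\<bar>" using assms(2,3) by (auto simp: abs_mult mult_left_le)
  then show "\<bar>a * s\<bar> + \<bar>b * t\<bar> < 1" using assms(1) by linarith
  then show "1 - a * s - b * t > 0" by linarith
qed

lemma continuous_on_euler_integrand_half_angle:
  assumes "\<And>s t. s \<in> {0..1} \<Longrightarrow> t \<in> {0..1} \<Longrightarrow> 1 - z1 * s - z2 * t > 0 \<and> 1 - z3 * s - z4 * t > (0::real)"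
  shows "continuous_on ({-1..1} \<times> {-1..1}) (\<lambda>(x, y). 1 / (sqrt (1 - z1 * ((1 - x) / 2) - z2 * ((1 - y) / 2)) * sqrt (1 - z3 * ((1 - x) / 2) - z4 * ((1 - y) / 2))))"
  by (rule continuous_on_half_angles[OF continuous_on_euler_integrand[OF assms]])

lemma cosine_mean_half_angle_power: "cosine_mean (\<lambda>x. ((1 - x) / 2) ^ k) = inv_sqrt_coeff k"
proof -
  have "cosine_mean (\<lambda>x. ((1 - x) / 2) ^ k) = cosine_mean (\<lambda>x. (x\<^sup>2) ^ k)"
    by (rule cosine_mean_half_angle) (intro continuous_intros)
  then show ?thesis by (simp add: power_mult[symmetric] cosine_mean_even_power inv_sqrt_coeff_def)
qed

text \<open>
  The two linear factors are expanded into double series, which converge uniformly on the square;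
  the mean of \<open>X ^ (n\<^sub>1 + n\<^sub>3) * Y ^ (n\<^sub>2 + n\<^sub>4)\<close> supplies the remaining two Pochhammer quotients.
\<close>

lemma F_S_series_eq_euler_mean:
  fixes z :: "complex^2^2"
  assumes z: "z$1$1 = of_real z1" "z$2$1 = of_real z2" "z$1$2 = of_real z3" "z$2$2 = of_real z4"
    and small: "\<bar>z1\<bar> + \<bar>z2\<bar> < 1" "\<bar>z3\<bar> + \<bar>z4\<bar> < 1"
  shows "F_S_series z = of_real (euler_mean z1 z2 z3 z4)"
proof -
  define e where "e = (\<lambda>a b (i, j). inv_sqrt_coeff2 i j * a ^ i * b ^ j)"
  define f where "f = (\<lambda>(p, q) x y. e (z1 * ((1 - x) / 2)) (z2 * ((1 - y) / 2)) p * e (z3 * ((1 - x) / 2)) (z4 * ((1 - y) / 2)) q)"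
  have e_norm: "norm (e a b p) = e \<bar>a\<bar> \<bar>b\<bar> p" for a b p
    by (cases p) (simp add: e_def abs_mult power_abs inv_sqrt_coeff2_def pochhammer_nonneg)
  have e_sum: "(e a b has_sum 1 / sqrt (1 - a - b)) UNIV" "e \<bar>a\<bar> \<bar>b\<bar> summable_on UNIV" if "\<bar>a\<bar> + \<bar>b\<bar> < 1" for a b
    using has_sum_inv_sqrt_two_variables[OF that] by (simp_all add: e_def)
  have e_mono: "e \<bar>a * s\<bar> \<bar>b * t\<bar> p \<le> e \<bar>a\<bar> \<bar>b\<bar> p" if "s \<in> {0..1}" "t \<in> {0..1}" for a b s t p
  proof -
    have "\<bar>a * s\<bar> \<le> \<bar>a\<bar>" "\<bar>b * t\<bar> \<le> \<bar>b\<bar>" using that by (auto simp: abs_mult mult_left_le)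
    moreover have "0 \<le> inv_sqrt_coeff2 i j" for i j by (simp add: inv_sqrt_coeff2_def pochhammer_nonneg)
    ultimately show ?thesis
      by (cases p) (auto simp: e_def simp del: abs_mult intro!: mult_mono power_mono)
  qed
  have e0: "0 \<le> e \<bar>a\<bar> \<bar>b\<bar> p" for a b p using e_norm[of a b p] norm_ge_zero by metis
  have unit: "(1 - x) / 2 \<in> {0..1}" if "\<bar>x\<bar> \<le> 1" for x :: real using that by auto
  have series: "((\<lambda>n. cosine_mean (\<lambda>x. cosine_mean (\<lambda>y. f n x y))) has_sum euler_mean z1 z2 z3 z4) (UNIV \<times> UNIV)"
    unfolding euler_mean_def
  proof (rule has_sum_cosine_means)
    show "(\<lambda>(p, q). norm (e z1 z2 p) * norm (e z3 z4 q)) summable_on UNIV \<times> UNIV"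
      using e_sum[OF small(1)] e_sum[OF small(2)] by (intro has_sum_times(2)) (auto simp: e_norm[unfolded real_norm_def])
    show "\<bar>f n x y\<bar> \<le> (case n of (p, q) \<Rightarrow> norm (e z1 z2 p) * norm (e z3 z4 q))" if "\<bar>x\<bar> \<le> 1" "\<bar>y\<bar> \<le> 1" for n x y
    proof -
      obtain p q where Pair: "n = (p, q)" by (cases n)
      have "\<bar>f n x y\<bar> = e \<bar>z1 * ((1 - x) / 2)\<bar> \<bar>z2 * ((1 - y) / 2)\<bar> p * e \<bar>z3 * ((1 - x) / 2)\<bar> \<bar>z4 * ((1 - y) / 2)\<bar> q"
        unfolding Pair f_def prod.case abs_mult e_norm[unfolded real_norm_def] ..
      also have "\<dots> \<le> e \<bar>z1\<bar> \<bar>z2\<bar> p * e \<bar>z3\<bar> \<bar>z4\<bar> q"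
        by (intro mult_mono e_mono unit that e0)
      finally show ?thesis by (simp add: Pair e_norm[unfolded real_norm_def])
    qed
    show "continuous_on ({-1..1} \<times> {-1..1}) (\<lambda>(x, y). f n x y)" for n
      by (cases n) (auto simp: f_def e_def split_def intro!: continuous_intros)
    show "continuous_on ({-1..1} \<times> {-1..1}) (\<lambda>(x, y). 1 / (sqrt (1 - z1 * ((1 - x) / 2) - z2 * ((1 - y) / 2)) * sqrt (1 - z3 * ((1 - x) / 2) - z4 * ((1 - y) / 2))))"
      by (rule continuous_on_euler_integrand_half_angle)
         (use linear_factor_pos(2)[OF small(1)] linear_factor_pos(2)[OF small(2)] in auto)
    show "((\<lambda>n. f n x y) has_sum 1 / (sqrt (1 - z1 * ((1 - x) / 2) - z2 * ((1 - y) / 2)) * sqrt (1 - z3 * ((1 - x) / 2) - z4 * ((1 - y) / 2)))) (UNIV \<times> UNIV)"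
      if "\<bar>x\<bar> \<le> 1" "\<bar>y\<bar> \<le> 1" for x y
    proof -
      note s1 = e_sum[OF linear_factor_pos(1)[OF small(1) unit[OF that(1)] unit[OF that(2)]]]
      note s2 = e_sum[OF linear_factor_pos(1)[OF small(2) unit[OF that(1)] unit[OF that(2)]]]
      have "((\<lambda>(p, q). e (z1 * ((1 - x) / 2)) (z2 * ((1 - y) / 2)) p * e (z3 * ((1 - x) / 2)) (z4 * ((1 - y) / 2)) q) has_sum
          1 / sqrt (1 - z1 * ((1 - x) / 2) - z2 * ((1 - y) / 2)) * (1 / sqrt (1 - z3 * ((1 - x) / 2) - z4 * ((1 - y) / 2)))) (UNIV \<times> UNIV)"
        by (rule has_sum_times(1)[OF s1(1) _ s2(1)]) (unfold e_norm, rule s1(2), rule s2(2))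
      moreover have "(\<lambda>n. f n x y) = (\<lambda>(p, q). e (z1 * ((1 - x) / 2)) (z2 * ((1 - y) / 2)) p * e (z3 * ((1 - x) / 2)) (z4 * ((1 - y) / 2)) q)"
        by (auto simp: f_def)
      ultimately show ?thesis by (simp only: times_divide_times_eq mult_1)
    qed
  qed
  have "cosine_mean (\<lambda>x. cosine_mean (\<lambda>y. f ((n1, n2), (n3, n4)) x y))
      = inv_sqrt_coeff2 n1 n2 * inv_sqrt_coeff2 n3 n4 * inv_sqrt_coeff (n1 + n3) * inv_sqrt_coeff (n2 + n4)
        * z1 ^ n1 * z2 ^ n2 * z3 ^ n3 * z4 ^ n4" for n1 n2 n3 n4
  proof -
    define C where "C = inv_sqrt_coeff2 n1 n2 * inv_sqrt_coeff2 n3 n4 * z1 ^ n1 * z2 ^ n2 * z3 ^ n3 * z4 ^ n4"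
    have "f ((n1, n2), (n3, n4)) x y = (C * ((1 - x) / 2) ^ (n1 + n3)) * ((1 - y) / 2) ^ (n2 + n4)" for x y
      unfolding f_def e_def C_def prod.case power_mult_distrib power_add by (simp only: mult_ac)
    then have "cosine_mean (\<lambda>y. f ((n1, n2), (n3, n4)) x y) = (inv_sqrt_coeff (n2 + n4) * C) * ((1 - x) / 2) ^ (n1 + n3)" for x
      by (simp only: cosine_mean_mult_left cosine_mean_half_angle_power) (simp only: mult_ac)
    then have "cosine_mean (\<lambda>x. cosine_mean (\<lambda>y. f ((n1, n2), (n3, n4)) x y))
        = cosine_mean (\<lambda>x. (inv_sqrt_coeff (n2 + n4) * C) * ((1 - x) / 2) ^ (n1 + n3))"
      by (simp only:)
    also have "\<dots> = inv_sqrt_coeff (n2 + n4) * C * inv_sqrt_coeff (n1 + n3)"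
      by (simp only: cosine_mean_mult_left cosine_mean_half_angle_power)
    finally show ?thesis by (simp add: C_def mult_ac)
  qed
  note term_mean = this
  have "(\<lambda>n. cosine_mean (\<lambda>x. cosine_mean (\<lambda>y. f n x y))) = (\<lambda>((n1, n2), (n3, n4)).
      inv_sqrt_coeff2 n1 n2 * inv_sqrt_coeff2 n3 n4 * inv_sqrt_coeff (n1 + n3) * inv_sqrt_coeff (n2 + n4)
        * z1 ^ n1 * z2 ^ n2 * z3 ^ n3 * z4 ^ n4)"
    by (rule ext) (auto simp: term_mean)
  with series have "((\<lambda>((n1, n2), (n3, n4)). inv_sqrt_coeff2 n1 n2 * inv_sqrt_coeff2 n3 n4 * inv_sqrt_coeff (n1 + n3) * inv_sqrt_coeff (n2 + n4)
        * z1 ^ n1 * z2 ^ n2 * z3 ^ n3 * z4 ^ n4) has_sum euler_mean z1 z2 z3 z4) (UNIV \<times> UNIV)"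
    by (simp only:)
  then have "((\<lambda>(n1, n2, n3, n4). inv_sqrt_coeff2 n1 n2 * inv_sqrt_coeff2 n3 n4 * inv_sqrt_coeff (n1 + n3) * inv_sqrt_coeff (n2 + n4)
        * z1 ^ n1 * z2 ^ n2 * z3 ^ n3 * z4 ^ n4) has_sum euler_mean z1 z2 z3 z4) UNIV"
    by (subst has_sum_reindex_bij_witness[where i = "\<lambda>((a, b), (c, d)). (a, b, c, d)" and j = "\<lambda>(a, b, c, d). ((a, b), (c, d))"
          and T = "UNIV \<times> UNIV", OF _ _ _ _ _ refl]) auto
  then have "((\<lambda>n. complex_of_real (case n of (n1, n2, n3, n4) \<Rightarrow> inv_sqrt_coeff2 n1 n2 * inv_sqrt_coeff2 n3 n4 * inv_sqrt_coeff (n1 + n3) * inv_sqrt_coeff (n2 + n4)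
        * z1 ^ n1 * z2 ^ n2 * z3 ^ n3 * z4 ^ n4)) has_sum of_real (euler_mean z1 z2 z3 z4)) UNIV"
    by (rule has_sum_of_real)
  moreover have "complex_of_real (case n of (n1, n2, n3, n4) \<Rightarrow> inv_sqrt_coeff2 n1 n2 * inv_sqrt_coeff2 n3 n4 * inv_sqrt_coeff (n1 + n3) * inv_sqrt_coeff (n2 + n4)
        * z1 ^ n1 * z2 ^ n2 * z3 ^ n3 * z4 ^ n4)
     = (case n of (n1, n2, n3, n4) \<Rightarrow> (pochhammer (1/2) (n1 + n3) * pochhammer (1/2) (n2 + n4) *
         pochhammer (1/2) (n1 + n2) * pochhammer (1/2) (n3 + n4)) /
        (pochhammer 1 (n1 + n3) * pochhammer 1 (n2 + n4) *
         fact n1 * fact n2 * fact n3 * fact n4) *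
        (z$1$1) ^ n1 * (z$2$1) ^ n2 * (z$1$2) ^ n3 * (z$2$2) ^ n4)" for n
  proof -
    have "pochhammer (1/2) k = complex_of_real (pochhammer (1/2) k)" for k
      by (metis of_real_divide of_real_1 of_real_numeral pochhammer_of_real)
    then show ?thesis
      by (cases n) (simp add: z inv_sqrt_coeff_def inv_sqrt_coeff2_def pochhammer_fact[symmetric] mult_ac)
  qed
  ultimately show ?thesis unfolding F_S_series_def by (simp add: infsumI)
qed

lemma F_S_eq_euler_mean:
  fixes z :: "complex^2^2"
  assumes z: "z$1$1 = of_real z1" "z$2$1 = of_real z2" "z$1$2 = of_real z3" "z$2$2 = of_real z4"
    and pos: "\<And>s t. s \<in> {0..1} \<Longrightarrow> t \<in> {0..1} \<Longrightarrow> 1 - z1 * s - z2 * t > 0 \<and> 1 - z3 * s - z4 * t > 0"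
  shows "F_S z = of_real (euler_mean z1 z2 z3 z4)"
  unfolding F_S_def
  using F_S_series_eq_euler_mean[OF z] F_S_integral_eq_euler_mean[OF z pos] by (simp add: z)

lemma euler_mean_swap:
  assumes pos: "\<And>s t. s \<in> {0..1} \<Longrightarrow> t \<in> {0..1} \<Longrightarrow> 1 - z1 * s - z2 * t > 0 \<and> 1 - z3 * s - z4 * t > 0"
  shows "euler_mean z1 z2 z3 z4 = euler_mean z4 z3 z2 z1"
proof -
  have "1 / (sqrt (1 - z1 * X - z2 * Y) * sqrt (1 - z3 * X - z4 * Y))
      = 1 / (sqrt (1 - z4 * Y - z3 * X) * sqrt (1 - z2 * Y - z1 * X))" for X Y
  proof -
    have "1 - z1 * X - z2 * Y = 1 - z2 * Y - z1 * X" "1 - z3 * X - z4 * Y = 1 - z4 * Y - z3 * X" by simp_all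
    then show ?thesis by (simp only: mult.commute)
  qed
  note factors = this
  show ?thesis
    unfolding euler_mean_def
    by (rule trans[OF cosine_mean_swap[OF continuous_on_euler_integrand_half_angle]], rule pos, assumption+)
       (intro cosine_mean_cong factors)
qed

section \<open>The two expressions for the limit\<close>

text \<open>
  Put \<open>D = A (1 - s) + B s\<close>.  Then the first factor is \<open>D / A\<close>, and the second one is \<open>D / (A c\<^sub>3\<^sup>2)\<close> times the
  quadratic form evaluated at the Moebius image \<open>(B s - A (1 - s)) / D\<close> of \<open>2 s - 1\<close>.  The two square roots of
  \<open>D\<close> multiply to \<open>D\<close>, whose reciprocal is, up to a constant, the density of the Moebius substitution; what is left
  is the torus mean.
\<close>

lemma euler_mean_eq_torus_mean:
  assumes c: "\<And>i. c$i > 0" and A: "c$1 > c$2" and B: "c$3 > c$4"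
  defines "A \<equiv> (c$1)\<^sup>2 - (c$2)\<^sup>2" and "B \<equiv> (c$3)\<^sup>2 - (c$4)\<^sup>2"
  defines "z1 \<equiv> 1 - B / A" and "z3 \<equiv> 1 - ((c$1)\<^sup>2 * B) / ((c$3)\<^sup>2 * A)" and "z4 \<equiv> 1 - (c$4)\<^sup>2 / (c$3)\<^sup>2"
  shows "\<And>s t. s \<in> {0..1} \<Longrightarrow> t \<in> {0..1} \<Longrightarrow> 1 - z1 * s - 0 * t > 0 \<and> 1 - z3 * s - z4 * t > 0"
    and "euler_mean z1 0 z3 z4 = sqrt (A / B) * c$3 * torus_mean c"
proof -
  have A0: "A > 0" and B0: "B > 0"
    using c[of 2] c[of 4] assms(2,3) unfolding A_def B_def by (auto intro!: power_strict_mono)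
  have c3: "c$3 > 0" by (rule c)
  define D where "D = (\<lambda>s. A * (1 - s) + B * s)"
  have D: "D s > 0" if "s \<in> {0..1}" for s
  proof (cases "s = 0")
    case False
    then show ?thesis using that A0 B0 by (auto simp: D_def intro!: add_nonneg_pos)
  qed (use A0 in \<open>simp add: D_def\<close>)
  have L1: "1 - z1 * s - 0 * t = D s / A" for s t
    using A0 by (simp add: z1_def D_def field_simps)
  have L2: "1 - z3 * s - z4 * t = D s / (A * (c$3)\<^sup>2) * quad_form c ((B * s - A * (1 - s)) / D s) (1 - 2 * t)"
    if "s \<in> {0..1}" for s t
  proof -
    have "D s * quad_form c ((B * s - A * (1 - s)) / D s) (1 - 2 * t)
        = B * s * ((c$1)\<^sup>2 * (1 - t) + (c$2)\<^sup>2 * t) + A * (1 - s) * ((c$3)\<^sup>2 * (1 - t) + (c$4)\<^sup>2 * t)"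
    proof -
      have "D s * (1 + (B * s - A * (1 - s)) / D s) = 2 * (B * s)" "D s * (1 - (B * s - A * (1 - s)) / D s) = 2 * (A * (1 - s))"
        using D[OF that] by (simp_all add: field_simps) (simp_all add: D_def algebra_simps)
      note e = this
      have "d * quad_form c \<nu> (1 - 2 * t)
        = ((d * (1 + \<nu>)) * ((c$1)\<^sup>2 * (2 - 2 * t) + (c$2)\<^sup>2 * (2 * t))
         + (d * (1 - \<nu>)) * ((c$3)\<^sup>2 * (2 - 2 * t) + (c$4)\<^sup>2 * (2 * t))) / 4" for d \<nu>
        unfolding quad_form_def by (simp add: algebra_simps)
      from this[of "D s" "(B * s - A * (1 - s)) / D s"] show ?thesis unfolding e by (simp add: algebra_simps)
    qed
    also have "\<dots> = A * (c$3)\<^sup>2 * (1 - z3 * s - z4 * t)"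
    proof -
      have "A * (c$3)\<^sup>2 * (1 - z3 * s - z4 * t) = A * (c$3)\<^sup>2 * (1 - s) + (c$1)\<^sup>2 * B * s - A * B * t"
        using A0 c3 by (simp add: z3_def z4_def B_def field_simps)
      moreover have "A * (c$3)\<^sup>2 * (1 - s) + (c$1)\<^sup>2 * B * s - A * B * t
         = B * s * ((c$1)\<^sup>2 * (1 - t) + (c$2)\<^sup>2 * t) + A * (1 - s) * ((c$3)\<^sup>2 * (1 - t) + (c$4)\<^sup>2 * t)"
        unfolding A_def B_def by (simp add: algebra_simps)
      ultimately show ?thesis by simp
    qed
    finally show ?thesis using A0 c3 by (simp add: field_simps)
  qed
  have \<mu>: "\<bar>(B * s - A * (1 - s)) / D s\<bar> \<le> 1" if "s \<in> {0..1}" for s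
  proof -
    have "0 \<le> A * (1 - s)" "0 \<le> B * s" using that A0 B0 by auto
    then have "\<bar>B * s - A * (1 - s)\<bar> \<le> D s" by (simp add: D_def abs_le_iff)
    then show ?thesis using D[OF that] by simp
  qed
  have quad: "quad_form c ((B * s - A * (1 - s)) / D s) (1 - 2 * t) > 0" if "s \<in> {0..1}" "t \<in> {0..1}" for s t
    using quad_form_pos[OF c \<mu>[OF that(1)], of "1 - 2 * t"] that by (auto simp: abs_le_iff)
  show pos: "1 - z1 * s - 0 * t > 0 \<and> 1 - z3 * s - z4 * t > 0" if st: "s \<in> {0..1}" "t \<in> {0..1}" for s t
    unfolding L1 L2[OF st(1)] using D[OF st(1)] quad[OF st] A0 c3 by auto
  define h where "h = (\<lambda>x. cosine_mean (\<lambda>y. 1 / sqrt (quad_form c x y)))"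
  have conth: "continuous_on {-1..1} h"
    unfolding h_def by (intro continuous_on_cosine_mean continuous_on_inverse_sqrt_quad_form c)
  define k where "k = (\<lambda>x. cosine_mean (\<lambda>y. 1 / (sqrt (1 - z1 * ((1 - x) / 2) - 0 * ((1 - y) / 2)) * sqrt (1 - z3 * ((1 - x) / 2) - z4 * ((1 - y) / 2)))))"
  have contk: "continuous_on {-1..1} k"
    unfolding k_def
    by (intro continuous_on_cosine_mean continuous_on_euler_integrand_half_angle pos)
  \<comment> \<open>the reflection makes \<open>s = 0\<close> correspond to \<open>x = -1\<close>, as in the Moebius lemma\<close>
  have "euler_mean z1 0 z3 z4 = cosine_mean (\<lambda>x. k (- x))"
    unfolding euler_mean_def k_def[symmetric] by (rule cosine_mean_reflect[OF contk, symmetric])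
  also have "\<dots> = cosine_mean (\<lambda>x. (sqrt (A / B) * c$3) * ((2 * sqrt (B * A) / (B * (1 + x) + A * (1 - x))) *\<^sub>R
            h ((B * (1 + x) - A * (1 - x)) / (B * (1 + x) + A * (1 - x)))))"
  proof (rule cosine_mean_cong)
    fix x :: real assume x: "\<bar>x\<bar> \<le> 1"
    define s where "s = (1 + x) / 2"
    have s: "s \<in> {0..1}" using x by (auto simp: s_def)
    have Ds: "B * (1 + x) + A * (1 - x) = 2 * D s" and Ns: "B * (1 + x) - A * (1 - x) = 2 * (B * s - A * (1 - s))"
      by (simp_all add: s_def D_def field_simps)
    have cancel: "2 * N / (2 * d) = N / d" for N d :: real by simp
    have "k (- x) = cosine_mean (\<lambda>y. (A * c$3 / D s) * (1 / sqrt (quad_form c ((B * s - A * (1 - s)) / D s) y)))"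
      unfolding k_def
    proof (rule cosine_mean_cong)
      fix y :: real
      have q: "1 - 2 * ((1 - y) / 2) = y" by (simp add: field_simps)
      have "sqrt (D s / A) * sqrt (D s / (A * (c$3)\<^sup>2) * quad_form c ((B * s - A * (1 - s)) / D s) y)
          = D s / (A * c$3) * sqrt (quad_form c ((B * s - A * (1 - s)) / D s) y)"
      proof -
        have "(a / b) * (a / (b * k) * q) = (a * a) / ((b * b) * k) * q" for a b k q :: real by simp
        from this[of "sqrt (D s)" "sqrt A"] show ?thesis
          using A0 c3 D[OF s] by (simp add: real_sqrt_mult real_sqrt_divide)
      qed
      then show "1 / (sqrt (1 - z1 * ((1 - - x) / 2) - 0 * ((1 - y) / 2)) * sqrt (1 - z3 * ((1 - - x) / 2) - z4 * ((1 - y) / 2)))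
          = (A * c$3 / D s) * (1 / sqrt (quad_form c ((B * s - A * (1 - s)) / D s) y))"
        using L1[of s "(1 - y) / 2"] L2[OF s, of "(1 - y) / 2"] unfolding q by (simp add: s_def)
    qed
    also have "\<dots> = A * c$3 / D s * h ((B * s - A * (1 - s)) / D s)"
      unfolding h_def by (rule cosine_mean_mult_left)
    also have "A * c$3 / D s = (sqrt (A / B) * c$3) * (2 * sqrt (B * A) / (2 * D s))"
      using A0 B0 by (simp add: real_sqrt_mult real_sqrt_divide)
    finally show "k (- x) = (sqrt (A / B) * c$3) * ((2 * sqrt (B * A) / (B * (1 + x) + A * (1 - x))) *\<^sub>R
            h ((B * (1 + x) - A * (1 - x)) / (B * (1 + x) + A * (1 - x))))"
      unfolding Ds Ns cancel[of "B * s - A * (1 - s)"] by simp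
  qed
  also have "\<dots> = sqrt (A / B) * c$3 * torus_mean c"
    unfolding cosine_mean_mult_left cosine_mean_Moebius[OF conth B0 A0] by (simp add: torus_mean_def h_def)
  finally show "euler_mean z1 0 z3 z4 = sqrt (A / B) * c$3 * torus_mean c" .
qed

theorem theorem3:
  fixes c :: "real^4" and z w :: "complex^2^2"
  assumes "c$1 > c$2" and "c$2 > c$3" and "c$3 > c$4" and "c$4 > 0"
    and z: "z = vector
      [vector [of_real (1 - ((c$3)\<^sup>2 - (c$4)\<^sup>2) / ((c$1)\<^sup>2 - (c$2)\<^sup>2)),
               of_real (1 - ((c$1)\<^sup>2 * ((c$3)\<^sup>2 - (c$4)\<^sup>2)) / ((c$3)\<^sup>2 * ((c$1)\<^sup>2 - (c$2)\<^sup>2)))],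
       vector [0,
               of_real (1 - (c$4)\<^sup>2 / (c$3)\<^sup>2)]]"
    and w: "w = vector
      [vector [of_real (1 - (c$4)\<^sup>2 / (c$2)\<^sup>2),
               0],
       vector [of_real (1 - ((c$1)\<^sup>2 * ((c$2)\<^sup>2 - (c$4)\<^sup>2)) / ((c$2)\<^sup>2 * ((c$1)\<^sup>2 - (c$3)\<^sup>2))),
               of_real (1 - ((c$2)\<^sup>2 - (c$4)\<^sup>2) / ((c$1)\<^sup>2 - (c$3)\<^sup>2))]]"
  shows "(\<forall>i. (\<lambda>n. ((m ^^ n) c) $ i) \<longlonglongrightarrow> m_common_limit c)
    \<and> complex_of_real (m_common_limit c)
        = complex_of_real (sqrt (((c$1)\<^sup>2 - (c$2)\<^sup>2) / ((c$3)\<^sup>2 - (c$4)\<^sup>2)))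
            * (complex_of_real (c$3) / F_S z)
    \<and> complex_of_real (m_common_limit c)
        = complex_of_real (sqrt (((c$1)\<^sup>2 - (c$3)\<^sup>2) / ((c$2)\<^sup>2 - (c$4)\<^sup>2)))
            * (complex_of_real (c$2) / F_S w)"
proof -
  have ord: "diamond_ordered c" using assms(1-4) by (simp add: diamond_ordered_def)
  have pos: "c$i > 0" for i by (rule diamond_ordered_bounds(3)[OF ord])
  note lim = m_common_limit_eq_torus_mean[OF ord]
  have ratio: "complex_of_real (m_common_limit c) = complex_of_real r * (complex_of_real x / complex_of_real (r * x * torus_mean c))"
    if "r > 0" "x > 0" for r x
    using that lim(2) by (simp add: lim(3))
  have sq: "x\<^sup>2 > y\<^sup>2" if "x > y" "y > 0" for x y :: real using that by (intro power_strict_mono) auto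
  note Fz = euler_mean_eq_torus_mean[of c, OF pos assms(1,3)]
  have "F_S z = of_real (sqrt (((c$1)\<^sup>2 - (c$2)\<^sup>2) / ((c$3)\<^sup>2 - (c$4)\<^sup>2)) * c$3 * torus_mean c)"
    by (subst F_S_eq_euler_mean[OF _ _ _ _ Fz(1)]) (simp_all add: z Fz(2))
  moreover have "complex_of_real (m_common_limit c)
        = complex_of_real (sqrt (((c$1)\<^sup>2 - (c$2)\<^sup>2) / ((c$3)\<^sup>2 - (c$4)\<^sup>2))) * (complex_of_real (c$3) /
           complex_of_real (sqrt (((c$1)\<^sup>2 - (c$2)\<^sup>2) / ((c$3)\<^sup>2 - (c$4)\<^sup>2)) * c$3 * torus_mean c))"
    using sq[OF assms(1) pos] sq[OF assms(3) pos] by (intro ratio pos) simp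
  moreover
  \<comment> \<open>the second expression is the first one for the vector with second and third entry exchanged\<close>
  define d :: "real^4" where "d = vector [c$1, c$3, c$2, c$4]"
  have d: "d$1 = c$1" "d$2 = c$3" "d$3 = c$2" "d$4 = c$4" by (simp_all add: d_def vector_def)
  have dpos: "d$i > 0" for i using exhaust_4[of i] pos by (auto simp: d)
  have d_gt: "d$1 > d$2" "d$3 > d$4" using assms(1-3) by (auto simp: d)
  define z1 z3 z4 where "z1 = 1 - ((c$2)\<^sup>2 - (c$4)\<^sup>2) / ((c$1)\<^sup>2 - (c$3)\<^sup>2)"
    and "z3 = 1 - ((c$1)\<^sup>2 * ((c$2)\<^sup>2 - (c$4)\<^sup>2)) / ((c$2)\<^sup>2 * ((c$1)\<^sup>2 - (c$3)\<^sup>2))"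
    and "z4 = 1 - (c$4)\<^sup>2 / (c$2)\<^sup>2"
  note Fw = euler_mean_eq_torus_mean[of d, OF dpos d_gt,
      unfolded d torus_mean_swap[of c d, OF pos d], folded z1_def z3_def z4_def]
  have F_S_w: "F_S w = of_real (euler_mean z4 z3 0 z1)"
  proof (rule F_S_eq_euler_mean)
    show "w$1$1 = of_real z4" "w$2$1 = of_real z3" "w$1$2 = of_real 0" "w$2$2 = of_real z1"
      by (simp_all add: w z1_def z3_def z4_def)
    show "1 - z4 * s - z3 * t > 0 \<and> 1 - 0 * s - z1 * t > 0" if "s \<in> {0..1}" "t \<in> {0..1}" for s t
      using Fw(1)[OF that(2,1)] by simp
  qed
  have "F_S w = of_real (sqrt (((c$1)\<^sup>2 - (c$3)\<^sup>2) / ((c$2)\<^sup>2 - (c$4)\<^sup>2)) * c$2 * torus_mean c)"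
  proof -
    have "euler_mean z1 0 z3 z4 = euler_mean z4 z3 0 z1" by (rule euler_mean_swap) (rule Fw(1))
    moreover have "euler_mean z1 0 z3 z4 = sqrt (((c$1)\<^sup>2 - (c$3)\<^sup>2) / ((c$2)\<^sup>2 - (c$4)\<^sup>2)) * c$2 * torus_mean c"
      by (rule Fw(2))
    ultimately show ?thesis unfolding F_S_w by simp
  qed
  moreover have "complex_of_real (m_common_limit c)
        = complex_of_real (sqrt (((c$1)\<^sup>2 - (c$3)\<^sup>2) / ((c$2)\<^sup>2 - (c$4)\<^sup>2))) * (complex_of_real (c$2) /
           complex_of_real (sqrt (((c$1)\<^sup>2 - (c$3)\<^sup>2) / ((c$2)\<^sup>2 - (c$4)\<^sup>2)) * c$2 * torus_mean c))"
    using sq[OF less_trans[OF assms(2,1)] pos] sq[OF less_trans[OF assms(3,2)] pos] by (intro ratio pos) simp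
  ultimately show ?thesis using lim(1) by simp
qed

end
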